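(* For any integer $r\geq0$, we have $C_{r,2}^1=2r$ and $C_{r,3}^1=3(2^r-1)$.
   Context: $\mathbb N=\{0,1,2,\dots\}$ and $m\geq1$. For $\xi=(u_1,\dots,u_m)\in\mathbb N^m$, $\deg\xi=u_1+\cdots+u_m$. $\Gamma(r)=\{\xi\in\mathbb N^m:\deg\xi\leq r\}$. ${\bf k}\in\mathbb N^m$ is the tuple with $1$ in the $k$-th entry and zeros elsewhere. $\leq$ is the product order on $\mathbb N^m$. An antichain sequence of $\mathbb N^m$ is a finite sequence of pairwise $\leq$-incomparable elements. $\mathrm{LUB}(\eta,\tau)$ is the entrywise maximum of $\eta,\tau\in\mathbb N^m$. For an antichain (sequence) $\bar\alpha$ of $\mathbb N^m$, $\gamma(\bar\alpha)=\{\mathrm{LUB}(\eta,\tau):\eta\neq\tau,\ \eta,\tau\in\bar\alpha\}$ and $\Gamma_{\bar\alpha}(p)=\{\alpha\in\bar\alpha:\deg\alpha\leq p\}$. $D_{r,\bar\alpha}$ is the smallest integer $p\geq r$ such that: for every $\tau\in\gamma(\Gamma_{\bar\alpha}(p))\setminus\Gamma(p)$ and $1\leq i<j\leq m$ such that $\tau-{\bf i}\geq\beta_1$ and $\tau-{\bf j}\geq\beta_2$ for some $\beta_1,\beta_2\in\Gamma_{\bar\alpha}(p)$, there exists a sequence $\eta_1,\dots,\eta_s$ in $\Gamma_{\bar\alpha}(p)$ and indices $k_1,\dots,k_s\in\{1,\dots,m\}$ with $k_1=i$, $k_s=j$, $\eta_\ell\leq\tau-{\bf k}_\ell$ for all $\ell$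 (where ${\bf k}_\ell$ has $1$ in entry $k_\ell$ and zeros elsewhere), and $\deg\mathrm{LUB}(\eta_\ell,\eta_{\ell+1})\leq p$ for $\ell=1,\dots,s-1$. Then $C_{r,m}^1=\max\{D_{r,\bar\alpha}:\bar\alpha\text{ an antichain sequence of }\mathbb N^m\}$. *)

theory Defs
  imports Main
begin

(* An m-tuple of natural numbers is a function vanishing outside {1..m}. With this encoding the
   product order is the pointwise order on functions, and sup is the entrywise maximum. *)

type_synonym tuple = "nat \<Rightarrow> nat"

definition tuples :: "nat \<Rightarrow> tuple set" where
  "tuples m = {\<xi>. \<forall>k. k \<notin> {1..m} \<longrightarrow> \<xi> k = 0}"

definition deg :: "nat \<Rightarrow> tuple \<Rightarrow> nat" where
  "deg m \<xi> = (\<Sum>k=1..m. \<xi> k)"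

definition tuples_upto :: "nat \<Rightarrow> nat \<Rightarrow> tuple set" where
  "tuples_upto m r = {\<xi> \<in> tuples m. deg m \<xi> \<le> r}"

definition unit_tuple :: "nat \<Rightarrow> tuple" where
  "unit_tuple k = (\<lambda>i. if i = k then 1 else 0)"

abbreviation LUB :: "tuple \<Rightarrow> tuple \<Rightarrow> tuple" where
  "LUB \<equiv> sup"

lemma LUB_entrywise: "LUB \<eta> \<tau> = (\<lambda>k. max (\<eta> k) (\<tau> k))"
  by (simp add: sup_fun_def sup_nat_def)

(* The inequality \<eta> \<le> \<tau> - k, where the difference has to be formed without truncation: it fails
   if the k-th entry of \<tau> is zero, since then \<tau> - k has a negative entry. *)
definition below_pred :: "tuple \<Rightarrow> tuple \<Rightarrow> nat \<Rightarrow> bool" where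
  "below_pred \<eta> \<tau> k \<longleftrightarrow> unit_tuple k \<le> \<tau> \<and> \<eta> \<le> \<tau> - unit_tuple k"

lemma below_pred_int:
  "below_pred \<eta> \<tau> k \<longleftrightarrow> (\<forall>i. int (\<eta> i) \<le> int (\<tau> i) - int (unit_tuple k i))"
  unfolding below_pred_def le_fun_def fun_diff_def by (force simp: unit_tuple_def split: if_splits)

definition antichain_seq :: "nat \<Rightarrow> tuple list \<Rightarrow> bool" where
  "antichain_seq m \<alpha>s \<longleftrightarrow> set \<alpha>s \<subseteq> tuples m \<and>
     (\<forall>a < length \<alpha>s. \<forall>b < length \<alpha>s. a \<noteq> b \<longrightarrow> \<not> \<alpha>s ! a \<le> \<alpha>s ! b)"

definition lubs :: "tuple set \<Rightarrow> tuple set" where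
  "lubs A = {LUB \<eta> \<tau> | \<eta> \<tau>. \<eta> \<in> A \<and> \<tau> \<in> A \<and> \<eta> \<noteq> \<tau>}"

definition seq_upto :: "nat \<Rightarrow> tuple list \<Rightarrow> nat \<Rightarrow> tuple set" where
  "seq_upto m \<alpha>s p = {\<alpha> \<in> set \<alpha>s. deg m \<alpha> \<le> p}"

definition D_cond :: "nat \<Rightarrow> tuple list \<Rightarrow> nat \<Rightarrow> bool" where
  "D_cond m \<alpha>s p \<longleftrightarrow>
     (\<forall>\<tau> \<in> lubs (seq_upto m \<alpha>s p) - tuples_upto m p.
      \<forall>i \<in> {1..m}. \<forall>j \<in> {1..m}. i < j \<longrightarrow>
        (\<exists>\<beta>1 \<in> seq_upto m \<alpha>s p. \<exists>\<beta>2 \<in> seq_upto m \<alpha>s p.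
           below_pred \<beta>1 \<tau> i \<and> below_pred \<beta>2 \<tau> j) \<longrightarrow>
        (\<exists>s \<ge> 1. \<exists>(\<eta> :: nat \<Rightarrow> tuple) (k :: nat \<Rightarrow> nat).
           (\<forall>l \<in> {1..s}. \<eta> l \<in> seq_upto m \<alpha>s p \<and> k l \<in> {1..m}) \<and>
           k 1 = i \<and> k s = j \<and>
           (\<forall>l \<in> {1..s}. below_pred (\<eta> l) \<tau> (k l)) \<and>
           (\<forall>l \<in> {1..<s}. deg m (LUB (\<eta> l) (\<eta> (Suc l))) \<le> p)))"

definition D_val :: "nat \<Rightarrow> nat \<Rightarrow> tuple list \<Rightarrow> nat" where
  "D_val m r \<alpha>s = (LEAST p. r \<le> p \<and> D_cond m \<alpha>s p)"

lemma D_cond_exists: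
  assumes "antichain_seq m \<alpha>s"
  shows "\<exists>p \<ge> r. D_cond m \<alpha>s p"
proof -
  let ?L = "lubs (set \<alpha>s)"
  have "?L \<subseteq> (\<lambda>(\<eta>, \<tau>). LUB \<eta> \<tau>) ` (set \<alpha>s \<times> set \<alpha>s)"
    unfolding lubs_def by auto
  then have fin: "finite ?L"
    by (rule finite_subset) simp
  define p where "p = r + (\<Sum>\<tau>\<in>?L. deg m \<tau>)"
  have "\<tau> \<in> tuples_upto m p" if "\<tau> \<in> lubs (seq_upto m \<alpha>s p)" for \<tau>
  proof -
    have L: "\<tau> \<in> ?L"
      using that unfolding lubs_def seq_upto_def by blast
    then have "deg m \<tau> \<le> p"
      using member_le_sum[of \<tau> ?L "deg m"] fin unfolding p_def by simp
    moreover have "\<tau> \<in> tuples m"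
      using L assms unfolding lubs_def antichain_seq_def tuples_def LUB_entrywise by fastforce
    ultimately show ?thesis
      unfolding tuples_upto_def by simp
  qed
  then have "D_cond m \<alpha>s p"
    unfolding D_cond_def by blast
  moreover have "r \<le> p"
    by (simp add: p_def)
  ultimately show ?thesis
    by blast
qed

definition D_values :: "nat \<Rightarrow> nat \<Rightarrow> nat set" where
  "D_values r m = {D_val m r \<alpha>s | \<alpha>s. antichain_seq m \<alpha>s}"

(* Max is meaningful only on finite nonempty sets. D_values is never empty, as the empty sequence is
   an antichain sequence, but its finiteness, i.e. the existence of the maximum, is not automatic. *)
definition C1 :: "nat \<Rightarrow> nat \<Rightarrow> nat" where
  "C1 r m = Max (D_values r m)"

lemma D_values_nonempty: "D_values r m \<noteq> {}"
proof -
  have "antichain_seq m []"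
    by (simp add: antichain_seq_def)
  then show ?thesis
    unfolding D_values_def by blast
qed

end

theory Submission
  imports Defs "HOL.Binomial"
begin

text \<open>Let \<open>N d\<close> be the number of points of degree \<open>d\<close> above some element of the antichain.
  If the condition defining \<open>D\<close> fails at \<open>p\<close>, then \<open>N\<close> grows from \<open>p - 1\<close> to \<open>p\<close> by more than
  the minimum allowed by Macaulay's theorem, since a set of minimal growth that acquires no new
  generator is connected below every \<open>\<tau>\<close>. For \<open>m = 3\<close>, writing \<open>G\<close> for the growth, Macaulay's
  bound reads \<open>N \<le> G choose 2\<close>, and a failure improves it to \<open>N \<le> G - 1 choose 2\<close>; for
  \<open>m = 2\<close> a failure means growth by at least 2. As \<open>N d\<close> is at most the number of all points of
  degree \<open>d\<close>, the failures stop in time. The bounds are attained by lexicographic antichains, whose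
  growth exceeds the minimum by exactly one in each degree.\<close>

section \<open>Growth of planar sets\<close>

lemma Suc_choose_two: "Suc n choose 2 = (n choose 2) + n"
  by (simp add: numeral_2_eq_2)

lemma choose_two_mono: "a \<le> b \<Longrightarrow> a choose 2 \<le> b choose 2"
  by (induction b rule: dec_induct) (auto simp: Suc_choose_two)

text \<open>As \<open>Q\<close> increases strictly wherever \<open>a v\<close> is positive, the
  positive \<open>a v\<close> are bounded by distinct numbers \<open>H - Q (Suc v)\<close> below
  \<open>H\<close>, hence sum to at most \<open>0 + 1 + ... + (H - 1)\<close>. In the induction
  \<open>H - Q n choose 2\<close> is the part of that sum still available.\<close>

lemma sum_le_choose_two:
  fixes a Q :: "nat \<Rightarrow> nat"
  assumes "\<And>v. v < V \<Longrightarrow> Q v \<le> Q (Suc v)"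
    and "\<And>v. v < V \<Longrightarrow> 0 < a v \<Longrightarrow> Q v < Q (Suc v) \<and> a v + Q (Suc v) \<le> H"
  shows "(\<Sum>v<V. a v) \<le> H choose 2"
proof -
  have "(\<Sum>v<n. a v) + (H - Q n choose 2) \<le> H choose 2" if "n \<le> V" for n
    using that
  proof (induction n)
    case 0
    then show ?case by (simp add: choose_two_mono)
  next
    case (Suc n)
    show ?case
    proof (cases "a n = 0")
      case True
      have "H - Q (Suc n) choose 2 \<le> H - Q n choose 2"
        using assms(1)[of n] Suc.prems by (intro choose_two_mono) auto
      with True Suc show ?thesis by simp
    next
      case False
      then have *: "Q n < Q (Suc n)" "a n + Q (Suc n) \<le> H"
        using assms(2)[of n] Suc.prems by auto
      have "Suc (H - Q (Suc n)) choose 2 \<le> H - Q n choose 2"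
        using * by (intro choose_two_mono) auto
      with * Suc show ?thesis by (simp add: Suc_choose_two)
    qed
  qed
  from this[of V] show ?thesis by simp
qed

definition spread :: "nat set \<Rightarrow> nat set" where
  "spread X = X \<union> Suc ` X"

lemma finite_spread: "finite X \<Longrightarrow> finite (spread X)"
  by (simp add: spread_def)

lemma card_spread:
  assumes "finite X" "X \<noteq> {}"
  shows "Suc (card X) \<le> card (spread X)"
proof -
  have "Suc (Max X) \<notin> X"
    using Max_ge[OF assms(1)] Suc_n_not_le_n by blast
  moreover have "insert (Suc (Max X)) X \<subseteq> spread X"
    using assms by (auto simp: spread_def)
  then have "card (insert (Suc (Max X)) X) \<le> card (spread X)"
    using assms(1) by (intro card_mono finite_spread)
  ultimately show ?thesis
    using assms by simp
qed

text \<open>\<open>Suc (Max X)\<close> is always new; an \<open>x\<close> followed by a gap below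
  \<open>y\<close> contributes \<open>Suc x\<close> as a second new element.\<close>

lemma card_spread_gap:
  assumes "finite X" "x \<in> X" "Suc x \<notin> X" "y \<in> X" "x < y"
  shows "card X + 2 \<le> card (spread X)"
proof -
  have "X \<noteq> {}" using assms by auto
  have "Suc (Max X) \<notin> X"
    using Max_ge[OF assms(1)] Suc_n_not_le_n by blast
  moreover have "x \<noteq> Max X"
    using assms Max_ge[OF assms(1) assms(4)] by linarith
  moreover have "insert (Suc x) (insert (Suc (Max X)) X) \<subseteq> spread X"
    using assms \<open>X \<noteq> {}\<close> by (auto simp: spread_def)
  then have "card (insert (Suc x) (insert (Suc (Max X)) X)) \<le> card (spread X)"
    using assms(1) by (intro card_mono finite_spread)
  ultimately show ?thesis
    using assms by simp
qed

text \<open>In three coordinates a point of given degree is determined by two of its entries.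
  Raising one of the three coordinates raises one entry of this pair or neither, which gives the
  three parts of the union.\<close>

definition shadow :: "(nat \<times> nat) set \<Rightarrow> (nat \<times> nat) set" where
  "shadow S = S \<union> (\<lambda>(v, x). (v, Suc x)) ` S \<union> (\<lambda>(v, x). (Suc v, x)) ` S"

definition row :: "(nat \<times> nat) set \<Rightarrow> nat \<Rightarrow> nat set" where
  "row S v = {x. (v, x) \<in> S}"

lemma finite_shadow: "finite S \<Longrightarrow> finite (shadow S)"
  by (simp add: shadow_def)

lemma finite_row: "finite S \<Longrightarrow> finite (row S v)"
  by (rule finite_subset[of _ "snd ` S"]) (auto simp: row_def intro!: image_eqI)

lemma spread_subset_row_shadow: "spread (row S v) \<subseteq> row (shadow S) v"
  by (auto simp: spread_def row_def shadow_def)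

lemma row_subset_row_shadow_Suc: "row S v \<subseteq> row (shadow S) (Suc v)"
  by (auto simp: row_def shadow_def)

lemma card_rows:
  assumes "finite S" "S \<subseteq> {..<V} \<times> UNIV"
  shows "card S = (\<Sum>v<V. card (row S v))"
proof -
  have "S = Sigma {..<V} (row S)"
    using assms(2) by (auto simp: row_def)
  also have "card \<dots> = (\<Sum>v<V. card (row S v))"
    by (rule card_SigmaI) (auto simp: finite_row assms(1))
  finally show ?thesis .
qed

text \<open>The row sizes of \<open>S\<close> and the prefix sums \<open>Q\<close> of the growth of the rows satisfy
  the hypotheses of \<open>sum_le_choose_two\<close>. A point that keeps a row from being stable
  under moving down sharpens the bound for all the rows below it.\<close>

context
  fixes S :: "(nat \<times> nat) set" and V :: nat
  assumes fin: "finite S" and bd: "shadow S \<subseteq> {..<V} \<times> UNIV"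
begin

definition growth :: "nat \<Rightarrow> nat" where
  "growth v = card (row (shadow S) v) - card (row S v)"

definition prefix_growth :: "nat \<Rightarrow> nat" where
  "prefix_growth n = (\<Sum>v<n. growth v)"

lemma row_le: "card (row S v) \<le> card (row (shadow S) v)"
  using fin by (intro card_mono finite_row finite_shadow) (auto simp: row_def shadow_def)

lemma card_row_shadow: "card (row (shadow S) v) = card (row S v) + growth v"
  using row_le[of v] by (simp add: growth_def)

lemma card_shadow: "card (shadow S) = card S + prefix_growth V"
proof -
  have "S \<subseteq> {..<V} \<times> UNIV" using bd by (auto simp: shadow_def)
  then show ?thesis
    using card_rows[OF fin, of V] card_rows[OF finite_shadow[OF fin] bd]
    by (simp add: card_row_shadow sum.distrib prefix_growth_def)
qed

lemma growth_pos:
  assumes "row S v \<noteq> {}"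
  shows "0 < growth v"
proof -
  have "card (spread (row S v)) \<le> card (row (shadow S) v)"
    using fin by (intro card_mono spread_subset_row_shadow finite_row finite_shadow)
  then show ?thesis
    using card_spread[OF finite_row[OF fin] assms] by (simp add: card_row_shadow)
qed

lemma row_empty: "V \<le> v \<Longrightarrow> row S v = {}" "V \<le> v \<Longrightarrow> growth v = 0"
proof -
  assume "V \<le> v"
  then have "row (shadow S) v = {}" using bd by (fastforce simp: row_def)
  then show "row S v = {}" "growth v = 0"
    by (auto simp: growth_def row_def shadow_def)
qed

text \<open>Row \<open>v\<close> of \<open>S\<close> reappears in row \<open>Suc v\<close> of the
  shadow, so row size plus growth up to that row never decreases with \<open>v\<close>.\<close>

lemma card_row_le: "card (row S v) + prefix_growth (Suc v) \<le> card (row S (Suc v)) + prefix_growth (Suc (Suc v))"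
proof -
  have "card (row S v) \<le> card (row (shadow S) (Suc v))"
    using fin by (intro card_mono row_subset_row_shadow_Suc finite_row finite_shadow)
  then show ?thesis by (simp add: prefix_growth_def card_row_shadow)
qed

text \<open>The left side is monotone in \<open>v\<close> and reaches the right side at
  \<open>v = V\<close>, where row and growth vanish.\<close>

lemma card_row_prefix: "v \<le> V \<Longrightarrow> card (row S v) + prefix_growth (Suc v) \<le> prefix_growth V"
proof (induction v rule: inc_induct)
  case base
  then show ?case by (simp add: row_empty prefix_growth_def)
next
  case (step n)
  then show ?case using card_row_le[of n] by linarith
qed

text \<open>The point \<open>y\<close> lies in row \<open>Suc w\<close> of the shadow outside the
  copy of row \<open>w\<close>. The monotone quantity therefore jumps between \<open>w\<close> and
  \<open>Suc w\<close>, and all \<open>v\<close> up to \<open>w\<close> profit.\<close>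

lemma card_row_prefix_strict:
  assumes "y \<in> spread (row S (Suc w))" "y \<notin> row S w" "w < V" "v \<le> w"
  shows "Suc (card (row S v) + prefix_growth (Suc v)) \<le> prefix_growth V"
  using assms(4)
proof (induction v rule: inc_induct)
  case base
  have "insert y (row S w) \<subseteq> row (shadow S) (Suc w)"
    using assms(1) spread_subset_row_shadow[of S "Suc w"] row_subset_row_shadow_Suc[of S w] by auto
  then have "card (insert y (row S w)) \<le> card (row (shadow S) (Suc w))"
    using fin by (intro card_mono finite_row finite_shadow)
  then have "Suc (card (row S w)) \<le> card (row (shadow S) (Suc w))"
    using assms(2) fin by (simp add: finite_row)
  then show ?case
    using card_row_prefix[of "Suc w"] assms(3) by (simp add: prefix_growth_def card_row_shadow)
next
  case (step n)
  then show ?case using card_row_le[of n] by linarith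
qed

lemma shadow_bound_aux: "card S \<le> prefix_growth V choose 2"
proof -
  have "card S = (\<Sum>v<V. card (row S v))"
    using bd by (intro card_rows fin) (auto simp: shadow_def)
  also have "\<dots> \<le> prefix_growth V choose 2"
  proof (rule sum_le_choose_two)
    fix v assume v: "v < V" "0 < card (row S v)"
    then have "row S v \<noteq> {}" by auto
    with v show "prefix_growth v < prefix_growth (Suc v) \<and>
        card (row S v) + prefix_growth (Suc v) \<le> prefix_growth V"
      using card_row_prefix[of v] growth_pos[of v] by (auto simp: prefix_growth_def)
  qed (simp add: prefix_growth_def)
  finally show ?thesis .
qed

text \<open>Both witnesses save one unit. Because of \<open>y\<close>, rows up to \<open>u\<close>
  satisfy the bound with \<open>H\<close> lowered by one. Because of \<open>x\<close>, row
  \<open>Suc u\<close> grows by one more than its spread requires, so for the later rows one unit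
  can be taken off the prefix sums instead.\<close>

lemma shadow_bound_strict_aux:
  assumes c: "x \<in> row S u" "x \<notin> spread (row S (Suc u))"
    and y: "y \<in> spread (row S (Suc w))" "y \<notin> row S w" "u \<le> w"
  shows "card S \<le> prefix_growth V - 1 choose 2"
proof -
  have "row S (Suc w) \<noteq> {}" using y(1) by (auto simp: spread_def)
  then have wV: "w < V" using row_empty(1)[of "Suc w"] not_less by fastforce
  have "insert x (spread (row S (Suc u))) \<subseteq> row (shadow S) (Suc u)"
    using c spread_subset_row_shadow[of S "Suc u"] row_subset_row_shadow_Suc[of S u] by auto
  then have "card (insert x (spread (row S (Suc u)))) \<le> card (row (shadow S) (Suc u))"
    using fin by (intro card_mono finite_row finite_shadow)
  then have cx: "Suc (card (spread (row S (Suc u)))) \<le> card (row S (Suc u)) + growth (Suc u)"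
    using c(2) fin by (simp add: finite_row finite_spread card_row_shadow)
  have g: "0 < growth (Suc u)" "row S (Suc u) \<noteq> {} \<Longrightarrow> 1 < growth (Suc u)"
  proof -
    show "1 < growth (Suc u)" if "row S (Suc u) \<noteq> {}"
      using card_spread[OF finite_row[OF fin] that] cx by simp
    then show "0 < growth (Suc u)"
      using cx by (cases "row S (Suc u) = {}") auto
  qed
  \<comment> \<open>The surplus of row \<open>Suc u\<close> is removed from every prefix sum that
    includes it.\<close>
  define Q where "Q v = (if v \<le> Suc u then prefix_growth v else prefix_growth v - 1)" for v
  have "card S = (\<Sum>v<V. card (row S v))"
    using bd by (intro card_rows fin) (auto simp: shadow_def)
  also have "\<dots> \<le> prefix_growth V - 1 choose 2"
  proof (rule sum_le_choose_two[where Q = Q])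
    fix v assume "v < V"
    consider "v \<le> u" | "v = Suc u" | "Suc u < v" by linarith
    then show "Q v \<le> Q (Suc v)"
      using g(1) by cases (auto simp: Q_def prefix_growth_def)
  next
    fix v assume v: "v < V" "0 < card (row S v)"
    then have ne: "row S v \<noteq> {}" by auto
    consider "v \<le> u" | "v = Suc u" | "Suc u < v" by linarith
    then show "Q v < Q (Suc v) \<and> card (row S v) + Q (Suc v) \<le> prefix_growth V - 1"
    proof cases
      case 1
      then show ?thesis
        using card_row_prefix_strict[OF y(1,2) wV, of v] y(3) growth_pos[OF ne]
        by (auto simp: Q_def prefix_growth_def)
    next
      case 2
      then show ?thesis
        using card_row_prefix[of v] v(1) g(2) ne by (auto simp: Q_def prefix_growth_def)
    next
      case 3
      \<comment> \<open>The prefix sum at \<open>v\<close> contains the positive growth of row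
        \<open>Suc u\<close>, so the subtraction in \<open>Q\<close> does not truncate and
        \<open>Q\<close> stays strictly increasing.\<close>
      have "{Suc u} \<subseteq> {..<v}" using 3 by auto
      then have "growth (Suc u) \<le> prefix_growth v"
        unfolding prefix_growth_def by (intro member_le_sum) auto
      then show ?thesis
        using card_row_prefix[of v] v(1) growth_pos[OF ne] 3 g(1)
        by (auto simp: Q_def prefix_growth_def)
    qed
  qed
  finally show ?thesis .
qed

end

lemma shadow_in_rows:
  assumes "finite S"
  obtains V where "shadow S \<subseteq> {..<V} \<times> UNIV"
proof -
  have "finite (fst ` shadow S)" using assms by (simp add: finite_shadow)
  then obtain V where "\<forall>v \<in> fst ` shadow S. v < V"
    using finite_nat_set_iff_bounded by blast
  then show thesis by (intro that[of V]) force
qed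

lemma shadow_bound:
  assumes "finite S"
  shows "card S \<le> card (shadow S) - card S choose 2"
proof -
  obtain V where "shadow S \<subseteq> {..<V} \<times> UNIV" using shadow_in_rows[OF assms] .
  from shadow_bound_aux[OF assms this] card_shadow[OF assms this] show ?thesis by simp
qed

text \<open>The conditions on \<open>x\<close> say that it is outside the spread of row
  \<open>Suc u\<close>; those on \<open>y\<close> say that the spread of row \<open>Suc w\<close> is
  not contained in row \<open>w\<close>.\<close>

lemma shadow_bound_strict:
  assumes "finite S" "(u, x) \<in> S" "(Suc u, x) \<notin> S" "\<And>z. x = Suc z \<Longrightarrow> (Suc u, z) \<notin> S"
    and "(Suc w, y) \<in> S" "u \<le> w" "(w, y) \<notin> S \<or> (w, Suc y) \<notin> S"
  shows "card S \<le> card (shadow S) - card S - 1 choose 2"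
proof -
  obtain V where V: "shadow S \<subseteq> {..<V} \<times> UNIV" using shadow_in_rows[OF assms(1)] .
  have 1: "x \<in> row S u" "x \<notin> spread (row S (Suc u))"
    using assms(2,3,4) by (auto simp: row_def spread_def)
  obtain y' where 2: "y' \<in> spread (row S (Suc w))" "y' \<notin> row S w"
    using assms(5,7) by (auto simp: row_def spread_def)
  show ?thesis
    using shadow_bound_strict_aux[OF assms(1) V 1 2 assms(6)] card_shadow[OF assms(1) V] by simp
qed

section \<open>Connectedness below a tuple\<close>

text \<open>This is the degree \<open>d\<close> part of the monomial ideal generated by
  \<open>A\<close>, tuples being read as exponents.\<close>

definition covered :: "nat \<Rightarrow> tuple set \<Rightarrow> nat \<Rightarrow> tuple set" where
  "covered m A d = {\<sigma> \<in> tuples m. deg m \<sigma> = d \<and> (\<exists>\<alpha>\<in>A. \<alpha> \<le> \<sigma>)}"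

text \<open>An exchange of one unit from entry \<open>k\<close> to entry \<open>i\<close>. It keeps
  the degree only if \<open>\<sigma> k\<close> is positive, as the subtraction truncates.\<close>

definition shift :: "tuple \<Rightarrow> nat \<Rightarrow> nat \<Rightarrow> tuple" where
  "shift \<sigma> i k = \<sigma>(i := Suc (\<sigma> i), k := \<sigma> k - 1)"

text \<open>For points of degree \<open>d\<close> the last condition means that they coincide or
  differ by one exchange. Paths of this relation become the sequences demanded by
  \<open>D_cond\<close> at \<open>p = Suc d\<close>.\<close>

definition linked :: "nat \<Rightarrow> nat \<Rightarrow> tuple set \<Rightarrow> tuple \<Rightarrow> tuple \<Rightarrow> tuple \<Rightarrow> bool" where
  "linked m d S \<tau> \<sigma> \<sigma>' \<longleftrightarrow> \<sigma> \<in> S \<and> \<sigma>' \<in> S \<and> \<sigma> \<le> \<tau> \<and> \<sigma>' \<le> \<tau> \<and> deg m (LUB \<sigma> \<sigma>') \<le> Suc d"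

lemma deg_upd:
  assumes "i \<in> {1..m}"
  shows "deg m (\<sigma>(i := c)) + \<sigma> i = deg m \<sigma> + c"
  using assms unfolding deg_def
  by (subst (1 2) sum.remove[of _ i]) auto

lemma deg_mono: "\<sigma> \<le> \<tau> \<Longrightarrow> deg m \<sigma> \<le> deg m \<tau>"
  by (auto simp: deg_def le_fun_def intro: sum_mono)

lemma deg_eq_imp_eq:
  assumes "\<sigma> \<le> \<tau>" "\<sigma> \<in> tuples m" "\<tau> \<in> tuples m" "deg m \<tau> \<le> deg m \<sigma>"
  shows "\<sigma> = \<tau>"
proof (rule ccontr)
  assume "\<sigma> \<noteq> \<tau>"
  then obtain i where i: "\<sigma> i \<noteq> \<tau> i" by auto
  then have "i \<in> {1..m}" using assms(2,3) unfolding tuples_def by force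
  moreover have "\<sigma> i < \<tau> i" using i assms(1) by (simp add: le_fun_def order_less_le)
  ultimately have "deg m \<sigma> < deg m \<tau>"
    unfolding deg_def using assms(1) by (intro sum_strict_mono_ex1) (auto simp: le_fun_def)
  with assms(4) show False by simp
qed

lemma less_deg_imp_less:
  assumes "deg m \<sigma> < deg m \<tau>"
  obtains i where "i \<in> {1..m}" "\<sigma> i < \<tau> i"
proof -
  have "\<exists>i\<in>{1..m}. \<not> \<tau> i \<le> \<sigma> i"
  proof (rule ccontr)
    assume "\<not> ?thesis"
    then have "deg m \<tau> \<le> deg m \<sigma>" unfolding deg_def by (intro sum_mono) blast
    with assms show False by simp
  qed
  then show thesis using that by force
qed

lemma linked_sym: "(linked m d S \<tau>)\<^sup>*\<^sup>* a b \<Longrightarrow> (linked m d S \<tau>)\<^sup>*\<^sup>* b a"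
proof -
  have "symp (linked m d S \<tau>)" by (auto simp: linked_def sup_commute intro: sympI)
  then show "(linked m d S \<tau>)\<^sup>*\<^sup>* a b \<Longrightarrow> (linked m d S \<tau>)\<^sup>*\<^sup>* b a"
    using symp_rtranclp by (metis sympD)
qed

lemma linked_mono: "(linked m d S \<tau>)\<^sup>*\<^sup>* a b \<Longrightarrow> \<tau> \<le> \<tau>' \<Longrightarrow> (linked m d S \<tau>')\<^sup>*\<^sup>* a b"
  by (erule rtranclp_mono[THEN predicate2D, rotated]) (auto simp: linked_def)

lemma shift_tuples:
  "\<sigma> \<in> tuples m \<Longrightarrow> i \<in> {1..m} \<Longrightarrow> shift \<sigma> i k \<in> tuples m"
  by (auto simp: tuples_def shift_def)

lemma deg_shift:
  assumes "i \<in> {1..m}" "k \<in> {1..m}" "i \<noteq> k" "0 < \<sigma> k"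
  shows "deg m (shift \<sigma> i k) = deg m \<sigma>"
  using deg_upd[OF assms(1), of \<sigma> "Suc (\<sigma> i)"] deg_upd[OF assms(2), of "\<sigma>(i := Suc (\<sigma> i))" "\<sigma> k - 1"] assms
  by (simp add: shift_def)

lemma linked_shift:
  assumes "\<sigma> \<in> S" "shift \<sigma> i k \<in> S" "deg m \<sigma> = d" "\<sigma> \<le> \<tau>" "\<sigma> i < \<tau> i" "i \<in> {1..m}" "i \<noteq> k"
  shows "linked m d S \<tau> \<sigma> (shift \<sigma> i k)"
proof -
  have "LUB \<sigma> (shift \<sigma> i k) \<le> \<sigma>(i := Suc (\<sigma> i))"
    by (auto simp: le_fun_def shift_def sup_nat_def)
  then have "deg m (LUB \<sigma> (shift \<sigma> i k)) \<le> deg m (\<sigma>(i := Suc (\<sigma> i)))"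
    by (rule deg_mono)
  also have "\<dots> = Suc d" using deg_upd[OF assms(6), of \<sigma> "Suc (\<sigma> i)"] assms(3) by simp
  moreover have "shift \<sigma> i k \<le> \<tau>"
    using assms(4,5) unfolding le_fun_def shift_def by (auto intro: le_trans[OF diff_le_self])
  ultimately show ?thesis using assms by (simp add: linked_def)
qed

section \<open>Three coordinates in arbitrary order\<close>

lemma set_1_3: "{1..3} = {1, 2, 3::nat}"
  by auto

lemma perm3_distinct:
  assumes "{i, j, k} = {1, 2, 3::nat}"
  shows "i \<noteq> j \<and> i \<noteq> k \<and> j \<noteq> k"
proof -
  have "card {i, j, k} = 3" using assms by simp
  then show ?thesis by (auto simp: card_insert_if split: if_splits)
qed

lemma perm3_mem: "{i, j, k} = {1, 2, 3::nat} \<Longrightarrow> i \<in> {1..3} \<and> j \<in> {1..3} \<and> k \<in> {1..3}"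
  unfolding set_1_3 by blast

lemma deg_perm3: "{i, j, k} = {1, 2, 3} \<Longrightarrow> deg 3 \<sigma> = \<sigma> i + \<sigma> j + \<sigma> k"
  using perm3_distinct[of i j k] unfolding deg_def set_1_3
  by (metis (no_types, lifting) add.assoc sum.empty sum.insert finite.emptyI finite.insertI insert_iff empty_iff add_0_right)

lemma tuple_eq_perm3:
  assumes "{i, j, k} = {1, 2, 3}" "\<sigma> \<in> tuples 3" "\<sigma>' \<in> tuples 3"
    and "deg 3 \<sigma> = deg 3 \<sigma>'" "\<sigma> k = \<sigma>' k" "\<sigma> i = \<sigma>' i"
  shows "\<sigma> = \<sigma>'"
proof
  fix l
  have "\<sigma> j = \<sigma>' j" using assms(4-6) by (simp add: deg_perm3[OF assms(1)])
  with assms show "\<sigma> l = \<sigma>' l"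
    unfolding tuples_def set_1_3 assms(1)[symmetric] by (cases "l \<in> {i, j, k}") auto
qed

text \<open>Negating the hypothesis of \<open>shadow_bound_strict\<close> in all the coordinate directions yields the
  premise below. The part of \<open>S\<close> below \<open>\<tau>\<close> is connected by induction on the distance of
  \<open>\<tau>\<close> from \<open>S\<close>: two points both differing from \<open>\<tau>\<close> in some entry \<open>k\<close> are
  connected already below \<open>\<tau> - k\<close>, and otherwise one of them differs from \<open>\<tau>\<close> in a
  single entry.\<close>

context
  fixes S :: "tuple set" and d :: nat
  assumes S: "S \<subseteq> {\<sigma> \<in> tuples 3. deg 3 \<sigma> = d}"
    and free: "\<And>i j k c \<sigma>. {i, j, k} = {1, 2, 3} \<Longrightarrow> c \<in> S \<Longrightarrow> \<sigma> \<in> S \<Longrightarrow> c k < \<sigma> k \<Longrightarrow>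
      0 < c i \<and> shift c k i \<in> S \<or> 0 < c j \<and> shift c k j \<in> S \<or> shift \<sigma> i k \<in> S"
begin

text \<open>One use of \<open>free\<close> yields an exchange of \<open>c\<close> or of
  \<open>\<sigma>\<close> that stays below \<open>\<tau>\<close>. Afterwards the two points usually
  have a common entry smaller than that of \<open>\<tau>\<close>, and \<open>IH\<close> connects
  them; only an exchange lowering \<open>c\<close> in entry \<open>j\<close> may leave no such
  entry.\<close>

lemma linked_corner:
  assumes perm: "{i, j, k} = {1, 2, 3}"
    and IH: "\<And>a b l. a \<in> S \<Longrightarrow> b \<in> S \<Longrightarrow> a \<le> \<tau> \<Longrightarrow> b \<le> \<tau> \<Longrightarrow> l \<in> {1..3} \<Longrightarrow> a l < \<tau> l \<Longrightarrow> b l < \<tau> l \<Longrightarrow>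
      (linked 3 d S \<tau>)\<^sup>*\<^sup>* a b"
    and c: "c \<in> S" "c \<le> \<tau>" "c k + 2 \<le> \<tau> k"
    and s: "\<sigma> \<in> S" "\<sigma> \<le> \<tau>" "\<sigma> k = \<tau> k" "\<sigma> i < \<tau> i" "c i = \<tau> i"
  shows "(linked 3 d S \<tau>)\<^sup>*\<^sup>* c \<sigma>"
proof -
  have dist: "i \<noteq> j" "i \<noteq> k" "j \<noteq> k" and mem: "i \<in> {1..3}" "j \<in> {1..3}" "k \<in> {1..3}"
    using perm3_distinct[OF perm] perm3_mem[OF perm] by auto
  have dc: "deg 3 c = d" "deg 3 \<sigma> = d" using S c s by auto
  have up_k: "linked 3 d S \<tau> c (shift c k l)" if "shift c k l \<in> S" "l \<noteq> k" for l
    using that c mem dc by (intro linked_shift) auto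
  have up_i: "linked 3 d S \<tau> \<sigma> (shift \<sigma> i l)" if "shift \<sigma> i l \<in> S" "l \<noteq> i" for l
    using that s mem dc by (intro linked_shift) auto
  have A: ?thesis if "shift \<sigma> i k \<in> S"
  proof -
    have l: "linked 3 d S \<tau> \<sigma> (shift \<sigma> i k)" using up_i that dist by auto
    have "(linked 3 d S \<tau>)\<^sup>*\<^sup>* c (shift \<sigma> i k)"
      by (rule IH[of _ _ k]) (use c s l mem dist in \<open>auto simp: linked_def shift_def\<close>)
    then show ?thesis using l linked_sym by (meson r_into_rtranclp rtranclp_trans)
  qed
  have B: ?thesis if "0 < c i" "shift c k i \<in> S"
  proof -
    have l: "linked 3 d S \<tau> c (shift c k i)" using up_k that dist by auto
    have "(linked 3 d S \<tau>)\<^sup>*\<^sup>* (shift c k i) \<sigma>"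
      by (rule IH[of _ _ i]) (use c s l mem dist that in \<open>auto simp: linked_def shift_def\<close>)
    then show ?thesis using l by (meson converse_rtranclp_into_rtranclp)
  qed
  have C: ?thesis if j: "0 < c j" "shift c k j \<in> S"
  proof -
    have l: "linked 3 d S \<tau> c (shift c k j)" using up_k j dist by auto
    have cj: "shift c k j j < \<tau> j"
      using c(2) j(1) dist by (auto simp: le_fun_def shift_def intro: less_le_trans)
    have to_c: ?thesis if "(linked 3 d S \<tau>)\<^sup>*\<^sup>* (shift c k j) \<sigma>"
      using l that by (meson converse_rtranclp_into_rtranclp)
    show ?thesis
    proof (cases "\<sigma> j < \<tau> j")
      case True
      have "(linked 3 d S \<tau>)\<^sup>*\<^sup>* (shift c k j) \<sigma>"
        by (rule IH[of _ _ j]) (use s l cj True mem in \<open>auto simp: linked_def\<close>)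
      then show ?thesis by (rule to_c)
    next
      case False
      \<comment> \<open>In the remaining case \<open>free\<close> is used again with
        \<open>c\<close> and \<open>\<sigma>\<close> interchanged and \<open>i\<close> as the raised
        entry, since \<open>\<sigma> i < c i\<close>.\<close>
      have "{k, j, i} = {1, 2, 3}" using perm by auto
      from free[OF this s(1) c(1)] s(4,5)
      consider "shift \<sigma> i k \<in> S" | "0 < \<sigma> j" "shift \<sigma> i j \<in> S" | "shift c k i \<in> S"
        by auto
      then show ?thesis
      proof cases
        case 1
        then show ?thesis by (rule A)
      next
        case 2
        have l': "linked 3 d S \<tau> \<sigma> (shift \<sigma> i j)" using up_i 2 dist by auto
        have "shift \<sigma> i j j < \<tau> j"
          using s(2) 2(1) dist by (auto simp: le_fun_def shift_def intro: less_le_trans)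
        then have "(linked 3 d S \<tau>)\<^sup>*\<^sup>* (shift c k j) (shift \<sigma> i j)"
          by (intro IH[of _ _ j]) (use s l l' cj mem in \<open>auto simp: linked_def\<close>)
        then show ?thesis
          using l' linked_sym to_c by (meson r_into_rtranclp rtranclp_trans)
      next
        case 3
        then show ?thesis using B s(4,5) by auto
      qed
    qed
  qed
  have "c k < \<sigma> k" using c(3) s(3) by simp
  from free[OF perm c(1) s(1) this] A B C show ?thesis by blast
qed

lemma linked_below:
  assumes "\<sigma> \<in> S" "\<sigma>' \<in> S" "\<sigma> \<le> \<tau>" "\<sigma>' \<le> \<tau>" "deg 3 \<tau> = Suc (d + n)"
  shows "(linked 3 d S \<tau>)\<^sup>*\<^sup>* \<sigma> \<sigma>'"
  using assms
proof (induction n arbitrary: \<tau> \<sigma> \<sigma>')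
  case 0
  have "deg 3 (LUB \<sigma> \<sigma>') \<le> deg 3 \<tau>" using 0 by (intro deg_mono) auto
  then show ?case using 0 by (intro r_into_rtranclp) (simp add: linked_def)
next
  case (Suc n)
  have IH: "(linked 3 d S \<tau>)\<^sup>*\<^sup>* a b"
    if h: "a \<in> S" "b \<in> S" "a \<le> \<tau>" "b \<le> \<tau>" "l \<in> {1..3}" "a l < \<tau> l" "b l < \<tau> l" for a b l
  proof -
    have "(linked 3 d S (\<tau>(l := \<tau> l - 1)))\<^sup>*\<^sup>* a b"
    proof (rule Suc.IH)
      show "deg 3 (\<tau>(l := \<tau> l - 1)) = Suc (d + n)"
        using deg_upd[OF h(5), of \<tau> "\<tau> l - 1"] h(6) Suc.prems(5) by simp
    qed (use h in \<open>auto simp: le_fun_def\<close>)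
    then show ?thesis by (rule linked_mono) (auto simp: le_fun_def)
  qed
  have corner: "(linked 3 d S \<tau>)\<^sup>*\<^sup>* c b"
    if p: "{i, j, k} = {1, 2, 3}" and h: "c \<in> S" "b \<in> S" "c \<le> \<tau>" "b \<le> \<tau>" "c i = \<tau> i" "c j = \<tau> j" "b k = \<tau> k"
    for c b i j k
  proof -
    have dd: "deg 3 c = d" "deg 3 b = d" using S h by auto
    have ck: "c k + 2 \<le> \<tau> k"
      using Suc.prems(5) dd(1) h(5,6) by (simp add: deg_perm3[OF p])
    have "b i < \<tau> i \<or> b j < \<tau> j"
      using Suc.prems(5) dd(2) h(7) by (auto simp: deg_perm3[OF p])
    then show ?thesis
    proof
      assume "b i < \<tau> i"
      show ?thesis
      proof (rule linked_corner[OF p _ h(1,3) ck h(2,4,7) \<open>b i < \<tau> i\<close> h(5)])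
      qed (rule IH)
    next
      assume "b j < \<tau> j"
      have p': "{j, i, k} = {1, 2, 3}" using p by auto
      show ?thesis
      proof (rule linked_corner[OF p' _ h(1,3) ck h(2,4,7) \<open>b j < \<tau> j\<close> h(6)])
      qed (rule IH)
    qed
  qed
  show ?case
  proof (cases "\<exists>l\<in>{1..3}. \<sigma> l < \<tau> l \<and> \<sigma>' l < \<tau> l")
    case True
    then show ?thesis using IH Suc.prems by blast
  next
    case False
    have le: "\<sigma> l \<le> \<tau> l" "\<sigma>' l \<le> \<tau> l" for l using Suc.prems by (auto simp: le_fun_def)
    \<comment> \<open>Each of the three entries of \<open>\<tau>\<close> is attained by
      \<open>\<sigma>\<close> or \<open>\<sigma>'\<close>, so one of them attains two. By its degree
      it misses the third, which the other one attains; this is the situation of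
      \<open>corner\<close>.\<close>
    have eq: "\<sigma> l = \<tau> l \<or> \<sigma>' l = \<tau> l" if "l \<in> {1, 2, 3}" for l
      using False le[of l] that unfolding set_1_3 by (auto simp: order_less_le)
    have p: "{1, 2, 3} = {1, 2, 3::nat}" "{2, 3, 1} = {1, 2, 3::nat}" "{1, 3, 2} = {1, 2, 3::nat}"
      by auto
    have "deg 3 \<sigma> = d" "deg 3 \<sigma>' = d" using S Suc.prems by auto
    then have ne: "\<not> (\<sigma> 1 = \<tau> 1 \<and> \<sigma> 2 = \<tau> 2 \<and> \<sigma> 3 = \<tau> 3)" "\<not> (\<sigma>' 1 = \<tau> 1 \<and> \<sigma>' 2 = \<tau> 2 \<and> \<sigma>' 3 = \<tau> 3)"
      using Suc.prems(5) by (auto simp: deg_perm3[OF p(1)])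
    note R = corner[OF p(1)] corner[OF p(2)] corner[OF p(3)]
    note R1 = R[OF Suc.prems(1-4)] and R2 = R[OF Suc.prems(2,1,4,3), THEN linked_sym]
    show ?thesis
      using R1 R2 eq[of 1] eq[of 2] eq[of 3] ne by blast
  qed
qed

end

section \<open>Growth at a failure of the condition\<close>

lemma antichain_eq:
  assumes "antichain_seq m \<alpha>s" "\<alpha> \<in> set \<alpha>s" "\<beta> \<in> set \<alpha>s" "\<alpha> \<le> \<beta>"
  shows "\<alpha> = \<beta>"
  using assms unfolding antichain_seq_def in_set_conv_nth by metis

lemma finite_covered: "finite (covered m A d)"
proof (rule finite_subset)
  have "\<sigma> k \<le> d" if "deg m \<sigma> = d" "k \<in> {1..m}" for \<sigma> k
    using that member_le_sum[of k "{1..m}" \<sigma>] by (simp add: deg_def)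
  then show "covered m A d \<subseteq> {\<sigma>. \<forall>k. (k \<in> {1..m} \<longrightarrow> \<sigma> k \<in> {..d}) \<and> (k \<notin> {1..m} \<longrightarrow> \<sigma> k = 0)}"
    unfolding covered_def tuples_def by blast
  show "finite {\<sigma>::tuple. \<forall>k. (k \<in> {1..m} \<longrightarrow> \<sigma> k \<in> {..d}) \<and> (k \<notin> {1..m} \<longrightarrow> \<sigma> k = 0)}"
    by (rule finite_set_of_finite_funs) auto
qed

lemma tuple_between:
  assumes "\<beta> \<le> \<tau>" "\<beta> \<in> tuples m" "deg m \<beta> \<le> d" "d \<le> deg m \<tau>"
  shows "\<exists>\<sigma>\<in>tuples m. deg m \<sigma> = d \<and> \<beta> \<le> \<sigma> \<and> \<sigma> \<le> \<tau>"
  using assms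
proof (induction "d - deg m \<beta>" arbitrary: \<beta>)
  case 0
  then show ?case by (intro bexI[of _ \<beta>]) auto
next
  case (Suc n)
  then have "deg m \<beta> < deg m \<tau>" by simp
  then obtain i where i: "i \<in> {1..m}" "\<beta> i < \<tau> i" using less_deg_imp_less by blast
  define \<beta>' where "\<beta>' = \<beta>(i := Suc (\<beta> i))"
  have "deg m \<beta>' = Suc (deg m \<beta>)"
    using deg_upd[OF i(1), of \<beta> "Suc (\<beta> i)"] by (simp add: \<beta>'_def)
  moreover have "\<beta>' \<le> \<tau>" "\<beta>' \<in> tuples m"
    using Suc.prems i by (auto simp: \<beta>'_def le_fun_def tuples_def)
  ultimately have "\<exists>\<sigma>\<in>tuples m. deg m \<sigma> = d \<and> \<beta>' \<le> \<sigma> \<and> \<sigma> \<le> \<tau>"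
    using Suc.hyps Suc.prems by (intro Suc.hyps(1)) auto
  moreover have "\<beta> \<le> \<beta>'" by (auto simp: \<beta>'_def le_fun_def)
  ultimately show ?case using order_trans by blast
qed

lemma covered_nonempty:
  assumes "\<alpha> \<in> A" "\<alpha> \<in> tuples m" "deg m \<alpha> \<le> d" "0 < m"
  shows "covered m A d \<noteq> {}"
proof -
  define \<tau> where "\<tau> = \<alpha>(1 := \<alpha> 1 + d)"
  have "deg m \<tau> = deg m \<alpha> + d"
    using deg_upd[of 1 m \<alpha> "\<alpha> 1 + d"] assms(4) by (simp add: \<tau>_def)
  moreover have "\<alpha> \<le> \<tau>" by (auto simp: \<tau>_def le_fun_def)
  ultimately show ?thesis
    using tuple_between[of \<alpha> \<tau> m d] assms by (auto simp: covered_def)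
qed

text \<open>A sequence as required by \<open>D_cond\<close> is read off a path of points of degree \<open>d\<close> by
  choosing an element of the antichain below each point. The starting point is repeated, as the
  path may consist of a single point, while \<open>k\<close> has to take both of the values \<open>i\<close> and \<open>j\<close>.\<close>

lemma D_condI:
  assumes sub: "set \<alpha>s \<subseteq> tuples m" and gen: "\<forall>\<alpha>\<in>set \<alpha>s. deg m \<alpha> \<noteq> Suc d"
    and conn: "\<And>\<tau> \<sigma> \<sigma>'. Suc d < deg m \<tau> \<Longrightarrow> \<sigma> \<in> covered m (set \<alpha>s) d \<Longrightarrow>
      \<sigma>' \<in> covered m (set \<alpha>s) d \<Longrightarrow> \<sigma> \<le> \<tau> \<Longrightarrow> \<sigma>' \<le> \<tau> \<Longrightarrow>
      (linked m d (covered m (set \<alpha>s) d) \<tau>)\<^sup>*\<^sup>* \<sigma> \<sigma>'"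
  shows "D_cond m \<alpha>s (Suc d)"
  unfolding D_cond_def
proof (intro ballI impI)
  let ?S = "covered m (set \<alpha>s) d"
  fix \<tau> i j
  assume \<tau>: "\<tau> \<in> lubs (seq_upto m \<alpha>s (Suc d)) - tuples_upto m (Suc d)"
    and ij: "i \<in> {1..m}" "j \<in> {1..m}" "i < j"
    and "\<exists>\<beta>1\<in>seq_upto m \<alpha>s (Suc d). \<exists>\<beta>2\<in>seq_upto m \<alpha>s (Suc d). below_pred \<beta>1 \<tau> i \<and> below_pred \<beta>2 \<tau> j"
  then obtain \<beta>1 \<beta>2 where \<beta>: "\<beta>1 \<in> seq_upto m \<alpha>s (Suc d)" "\<beta>2 \<in> seq_upto m \<alpha>s (Suc d)"
      "below_pred \<beta>1 \<tau> i" "below_pred \<beta>2 \<tau> j" by blast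
  have "\<tau> \<in> tuples m"
  proof -
    obtain a b where "\<tau> = LUB a b" "a \<in> set \<alpha>s" "b \<in> set \<alpha>s"
      using \<tau> unfolding lubs_def seq_upto_def by blast
    moreover from this sub have "a \<in> tuples m" "b \<in> tuples m" by auto
    ultimately show ?thesis by (simp add: tuples_def)
  qed
  with \<tau> have deg\<tau>: "Suc d < deg m \<tau>" by (auto simp: tuples_upto_def)
  \<comment> \<open>By \<open>gen\<close> the degree of \<open>\<beta>\<close> is at most
    \<open>d\<close>, while \<open>\<tau> - unit_tuple l\<close> has degree above \<open>d\<close>;
    a point of degree exactly \<open>d\<close> fits in between.\<close>
  have point: "\<exists>\<sigma>\<in>?S. \<sigma> \<le> \<tau> \<and> \<sigma> l < \<tau> l"
    if "\<beta> \<in> seq_upto m \<alpha>s (Suc d)" "below_pred \<beta> \<tau> l" "l \<in> {1..m}" for \<beta> l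
  proof -
    have l: "0 < \<tau> l" "\<beta> \<le> \<tau> - unit_tuple l"
      using that(2) by (auto simp: below_pred_def unit_tuple_def le_fun_def dest: spec[of _ l])
    have e: "\<tau> - unit_tuple l = \<tau>(l := \<tau> l - 1)" by (auto simp: unit_tuple_def)
    have "deg m (\<tau> - unit_tuple l) + 1 = deg m \<tau>"
      using deg_upd[OF that(3), of \<tau> "\<tau> l - 1"] l(1) unfolding e by simp
    moreover have "\<beta> \<in> tuples m" "\<beta> \<in> set \<alpha>s" "deg m \<beta> \<le> d"
      using that(1) sub gen by (auto simp: seq_upto_def le_Suc_eq)
    ultimately obtain \<sigma> where \<sigma>: "\<sigma> \<in> tuples m" "deg m \<sigma> = d" "\<beta> \<le> \<sigma>" "\<sigma> \<le> \<tau> - unit_tuple l"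
      using tuple_between[of \<beta> "\<tau> - unit_tuple l" m d] l(2) deg\<tau> by auto
    have "\<sigma> l < \<tau> l" using \<sigma>(4) l(1) unfolding e le_fun_def by (auto dest: spec[of _ l])
    moreover have "\<sigma> \<le> \<tau>"
      by (rule order_trans[OF \<sigma>(4)]) (simp add: e le_fun_def)
    ultimately show ?thesis
      using \<sigma> \<open>\<beta> \<in> set \<alpha>s\<close> by (auto simp: covered_def)
  qed
  obtain \<sigma>1 where s1: "\<sigma>1 \<in> ?S" "\<sigma>1 \<le> \<tau>" "\<sigma>1 i < \<tau> i" using point[OF \<beta>(1,3) ij(1)] by blast
  obtain \<sigma>2 where s2: "\<sigma>2 \<in> ?S" "\<sigma>2 \<le> \<tau>" "\<sigma>2 j < \<tau> j" using point[OF \<beta>(2,4) ij(2)] by blast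
  obtain n f where f: "f 0 = \<sigma>1" "f n = \<sigma>2" "\<And>l. l < n \<Longrightarrow> linked m d ?S \<tau> (f l) (f (Suc l))"
    using conn[OF deg\<tau> s1(1) s2(1) s1(2) s2(2)]
    by (auto simp: rtranclp_power relpowp_fun_conv)
  have fS: "f l \<in> ?S \<and> f l \<le> \<tau>" if "l \<le> n" for l
    using that f(3)[of l] f(2) s2 by (cases "l = n") (auto simp: linked_def)
  \<comment> \<open>Truncation gives \<open>g 1 = g 2 = f 0\<close>, and the path ends at index
    \<open>n + 2\<close>.\<close>
  define g where "g l = f (l - 2)" for l
  have gS: "g l \<in> ?S" "g l \<le> \<tau>" if "l \<in> {1..n+2}" for l
    using fS[of "l - 2"] that by (auto simp: g_def)
  have gl: "deg m (LUB (g l) (g (Suc l))) \<le> Suc d" if "l \<in> {1..<n+2}" for l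
  proof (cases "l = 1")
    case True
    then show ?thesis using s1(1) f(1) by (simp add: g_def covered_def)
  next
    case False
    then have "Suc l - 2 = Suc (l - 2)" "l - 2 < n" using that by auto
    then show ?thesis using f(3)[of "l - 2"] by (simp add: g_def linked_def)
  qed
  define \<eta> where "\<eta> l = (SOME \<alpha>. \<alpha> \<in> set \<alpha>s \<and> \<alpha> \<le> g l)" for l
  define k where "k l = (if l = 1 then i else if l = n + 2 then j
      else SOME k. k \<in> {1..m} \<and> g l k < \<tau> k)" for l
  have \<eta>: "\<eta> l \<in> set \<alpha>s \<and> \<eta> l \<le> g l" if "l \<in> {1..n+2}" for l
  proof -
    have "\<exists>\<alpha>. \<alpha> \<in> set \<alpha>s \<and> \<alpha> \<le> g l" using gS(1)[OF that] by (auto simp: covered_def)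
    from someI_ex[OF this] show ?thesis unfolding \<eta>_def .
  qed
  have k: "k l \<in> {1..m} \<and> g l (k l) < \<tau> (k l)" if "l \<in> {1..n+2}" for l
  proof -
    have "g 1 i < \<tau> i" "g (n+2) j < \<tau> j" using s1 s2 f by (auto simp: g_def)
    moreover have "\<exists>k. k \<in> {1..m} \<and> g l k < \<tau> k"
    proof -
      have "deg m (g l) < deg m \<tau>" using gS(1)[OF that] deg\<tau> by (simp add: covered_def)
      then show ?thesis using less_deg_imp_less by blast
    qed
    from someI_ex[OF this] have "l \<noteq> 1 \<Longrightarrow> l \<noteq> n + 2 \<Longrightarrow> ?thesis" by (simp add: k_def)
    ultimately show ?thesis using ij by (cases "l = 1"; cases "l = n + 2") (auto simp: k_def)
  qed
  have "\<eta> l \<in> seq_upto m \<alpha>s (Suc d)" if "l \<in> {1..n+2}" for l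
    using \<eta>[OF that] gS(1)[OF that] deg_mono[of "\<eta> l" "g l" m] by (auto simp: seq_upto_def covered_def)
  moreover have "below_pred (\<eta> l) \<tau> (k l)" if "l \<in> {1..n+2}" for l
    unfolding below_pred_int
  proof
    fix x
    have "\<eta> l x \<le> g l x" "g l x \<le> \<tau> x" "g l (k l) < \<tau> (k l)"
      using \<eta>[OF that] gS(2)[OF that] k[OF that] by (auto simp: le_fun_def)
    then show "int (\<eta> l x) \<le> int (\<tau> x) - int (unit_tuple (k l) x)"
      by (auto simp: unit_tuple_def)
  qed
  moreover have "deg m (LUB (\<eta> l) (\<eta> (Suc l))) \<le> Suc d" if "l \<in> {1..<n+2}" for l
  proof -
    have "LUB (\<eta> l) (\<eta> (Suc l)) \<le> LUB (g l) (g (Suc l))"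
      using \<eta>[of l] \<eta>[of "Suc l"] that by (intro sup_mono) auto
    then show ?thesis using deg_mono gl[OF that] order_trans by blast
  qed
  moreover have "k 1 = i" "k (n+2) = j" by (auto simp: k_def)
  ultimately show "\<exists>s\<ge>1. \<exists>\<eta> k.
      (\<forall>l\<in>{1..s}. \<eta> l \<in> seq_upto m \<alpha>s (Suc d) \<and> k l \<in> {1..m}) \<and>
      k 1 = i \<and> k s = j \<and> (\<forall>l\<in>{1..s}. below_pred (\<eta> l) \<tau> (k l)) \<and>
      (\<forall>l\<in>{1..<s}. deg m (LUB (\<eta> l) (\<eta> (Suc l))) \<le> Suc d)"
    using k by (intro exI[of _ "n+2"] conjI exI[of _ \<eta>] exI[of _ k]) auto
qed

text \<open>The points of degree \<open>Suc d\<close> inherited from degree \<open>d\<close>, as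
  opposed to new generators.\<close>

definition covered_up :: "nat \<Rightarrow> tuple set \<Rightarrow> nat \<Rightarrow> tuple set" where
  "covered_up m A d = (\<Union>l\<in>{1..m}. (\<lambda>\<sigma>. \<sigma>(l := Suc (\<sigma> l))) ` covered m A d)"

lemma covered_up_subset: "covered_up m A d \<subseteq> covered m A (Suc d)"
proof
  fix \<rho> assume "\<rho> \<in> covered_up m A d"
  then obtain \<sigma> l where \<sigma>: "\<rho> = \<sigma>(l := Suc (\<sigma> l))" "l \<in> {1..m}" "\<sigma> \<in> covered m A d"
    by (auto simp: covered_up_def)
  have "\<sigma> \<le> \<rho>" by (auto simp: \<sigma>(1) le_fun_def)
  moreover have "deg m \<rho> = Suc d"
    using deg_upd[OF \<sigma>(2), of \<sigma> "Suc (\<sigma> l)"] \<sigma> by (simp add: covered_def)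
  moreover have "\<rho> \<in> tuples m" using \<sigma> by (auto simp: covered_def tuples_def)
  ultimately show "\<rho> \<in> covered m A (Suc d)"
    using \<sigma>(3) order_trans by (fastforce simp: covered_def)
qed

text \<open>An inherited point lies strictly above some element of the antichain, so a generator of
  degree \<open>Suc d\<close> is never inherited.\<close>

lemma covered_up_psubset:
  assumes "antichain_seq m \<alpha>s" "\<alpha> \<in> set \<alpha>s" "deg m \<alpha> = Suc d"
  shows "covered_up m (set \<alpha>s) d \<subset> covered m (set \<alpha>s) (Suc d)"
proof -
  have "\<alpha> \<in> covered m (set \<alpha>s) (Suc d)"
    using assms by (auto simp: covered_def antichain_seq_def)
  moreover have "\<alpha> \<notin> covered_up m (set \<alpha>s) d"
  proof
    assume "\<alpha> \<in> covered_up m (set \<alpha>s) d"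
    then obtain \<sigma> l where \<sigma>: "\<alpha> = \<sigma>(l := Suc (\<sigma> l))" "\<sigma> \<in> covered m (set \<alpha>s) d"
      by (auto simp: covered_up_def)
    then obtain \<beta> where \<beta>: "\<beta> \<in> set \<alpha>s" "\<beta> \<le> \<sigma>" by (auto simp: covered_def)
    have "\<sigma> \<le> \<alpha>" by (auto simp: \<sigma>(1) le_fun_def)
    with \<beta> have "\<beta> = \<alpha>" using antichain_eq[OF assms(1) _ assms(2)] order_trans by blast
    with \<beta>(2) show False by (auto simp: \<sigma>(1) le_fun_def dest: spec[of _ l])
  qed
  ultimately show ?thesis using covered_up_subset by blast
qed

lemma card_covered_up_le: "card (covered_up m A d) \<le> card (covered m A (Suc d))"
  by (intro card_mono finite_covered covered_up_subset)

lemma card_covered_up_less: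
  assumes "antichain_seq m \<alpha>s" "\<alpha> \<in> set \<alpha>s" "deg m \<alpha> = Suc d"
  shows "card (covered_up m (set \<alpha>s) d) < card (covered m (set \<alpha>s) (Suc d))"
  by (intro psubset_card_mono finite_covered covered_up_psubset[OF assms])

lemma finite_covered_up: "finite (covered_up m A d)"
  by (rule finite_subset[OF covered_up_subset finite_covered])

text \<open>A failure needs two distinct antichain elements of degree at most \<open>Suc d\<close>.
  With nothing covered in degree \<open>d\<close>, both have degree \<open>Suc d\<close> and are
  covered points themselves.\<close>

lemma D_cond_fail_start:
  assumes "antichain_seq m \<alpha>s" "\<not> D_cond m \<alpha>s (Suc d)" "covered m (set \<alpha>s) d = {}" "0 < m"
  shows "2 \<le> card (covered m (set \<alpha>s) (Suc d))"
proof -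
  obtain \<alpha> \<beta> where ab: "\<alpha> \<in> seq_upto m \<alpha>s (Suc d)" "\<beta> \<in> seq_upto m \<alpha>s (Suc d)" "\<alpha> \<noteq> \<beta>"
    using assms(2) unfolding D_cond_def lubs_def by blast
  have sub: "set \<alpha>s \<subseteq> tuples m" using assms(1) by (simp add: antichain_seq_def)
  have "\<gamma> \<in> covered m (set \<alpha>s) (Suc d)" if "\<gamma> \<in> seq_upto m \<alpha>s (Suc d)" for \<gamma>
    using that covered_nonempty[of \<gamma> "set \<alpha>s" m d] assms(3,4) sub
    by (force simp: seq_upto_def covered_def le_Suc_eq)
  with ab have "{\<alpha>, \<beta>} \<subseteq> covered m (set \<alpha>s) (Suc d)" by blast
  from card_mono[OF finite_covered this] ab(3) show ?thesis by simp
qed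

text \<open>Projecting to two entries makes the planar bounds available. A new generator gives one
  point more than the inherited ones. Without one, a violation of the strict bound would rule out
  the hypotheses of \<open>shadow_bound_strict\<close> in all directions, making the points below
  each \<open>\<tau>\<close> connected and the condition true.\<close>

lemma D_cond_fail_3:
  assumes ac: "antichain_seq 3 \<alpha>s" and fail: "\<not> D_cond 3 \<alpha>s (Suc d)"
  defines "N \<equiv> \<lambda>d. card (covered 3 (set \<alpha>s) d)"
  shows "N d + 2 \<le> N (Suc d) \<and> N d \<le> N (Suc d) - N d - 1 choose 2"
proof (cases "covered 3 (set \<alpha>s) d = {}")
  case True
  then show ?thesis using D_cond_fail_start[OF ac fail] by (simp add: N_def)
next
  case False
  let ?S = "covered 3 (set \<alpha>s) d"
  define T where "T i k = (\<lambda>\<sigma>. (\<sigma> k, \<sigma> i)) ` ?S" for i k :: nat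
  have inj: "inj_on (\<lambda>\<sigma>. (\<sigma> k, \<sigma> i)) ?S" if "{i, j, k} = {1, 2, 3}" for i j k
    using tuple_eq_perm3[OF that] by (intro inj_onI) (auto simp: covered_def)
  have cT: "card (T i k) = N d" "finite (T i k)" if "{i, j, k} = {1, 2, 3}" for i j k
    unfolding T_def N_def using card_image[OF inj[OF that]] finite_covered by auto
  have sT: "card (shadow (T i k)) \<le> card (covered_up 3 (set \<alpha>s) d)"
    if p: "{i, j, k} = {1, 2, 3}" for i j k
  proof -
    have dist: "i \<noteq> j" "i \<noteq> k" "j \<noteq> k" and mem: "i \<in> {1..3}" "j \<in> {1..3}" "k \<in> {1..3}"
      using perm3_distinct[OF p] perm3_mem[OF p] by auto
    have "shadow (T i k) \<subseteq> (\<lambda>\<sigma>. (\<sigma> k, \<sigma> i)) ` covered_up 3 (set \<alpha>s) d"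
    proof
      fix y assume "y \<in> shadow (T i k)"
      then obtain \<sigma> where \<sigma>: "\<sigma> \<in> ?S"
        "y = (\<sigma> k, \<sigma> i) \<or> y = (\<sigma> k, Suc (\<sigma> i)) \<or> y = (Suc (\<sigma> k), \<sigma> i)"
        by (auto simp: shadow_def T_def)
      have "\<sigma>(l := Suc (\<sigma> l)) \<in> covered_up 3 (set \<alpha>s) d" if "l \<in> {1..3}" for l
        using \<sigma>(1) that by (auto simp: covered_up_def)
      from this[OF mem(1)] this[OF mem(2)] this[OF mem(3)] \<sigma>(2) dist
      show "y \<in> (\<lambda>\<sigma>. (\<sigma> k, \<sigma> i)) ` covered_up 3 (set \<alpha>s) d"
        by (elim disjE) (auto intro: rev_image_eqI)
    qed
    from surj_card_le[OF finite_covered_up this] show ?thesis .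
  qed
  have p: "{1, 2, 3} = {1, 2, 3::nat}" ..
  have pos: "0 < N d" using False finite_covered by (simp add: N_def card_gt_0_iff)
  define G where "G = card (covered_up 3 (set \<alpha>s) d) - N d"
  have bound: "N d \<le> G choose 2"
    using shadow_bound[OF cT(2)[OF p]] sT[OF p] choose_two_mono[of _ G] unfolding cT(1)[OF p] G_def
    by (meson diff_le_mono le_trans)
  have G: "2 \<le> G"
  proof (rule ccontr)
    assume "\<not> 2 \<le> G"
    then have "G choose 2 = 0" by (simp add: binomial_eq_0)
    with bound pos show False by simp
  qed
  show ?thesis
  proof (cases "\<exists>\<alpha>\<in>set \<alpha>s. deg 3 \<alpha> = Suc d")
    case True
    \<comment> \<open>The new generator makes \<open>G\<close> at most the growth minus one, so the
      plain bound for \<open>G\<close> suffices.\<close>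
    then have "Suc (N d + G) \<le> N (Suc d)"
      using card_covered_up_less[OF ac] G unfolding G_def N_def by fastforce
    moreover from this have "G choose 2 \<le> N (Suc d) - N d - 1 choose 2"
      by (intro choose_two_mono) simp
    ultimately show ?thesis using G bound by simp
  next
    case no_gen: False
    have le: "N d + G \<le> N (Suc d)"
      using card_covered_up_le[of 3 "set \<alpha>s" d] G unfolding G_def N_def by linarith
    have "N d \<le> N (Suc d) - N d - 1 choose 2"
    proof (rule ccontr)
      assume contra: "\<not> ?thesis"
      \<comment> \<open>Otherwise \<open>shadow_bound_strict\<close> applies with
        \<open>u = c k\<close>, \<open>x = c i\<close>, \<open>w = \<sigma> k - 1\<close>,
        \<open>y = \<sigma> i\<close>: the three missing planar points correspond to the three
        missing exchanges.\<close>
      have free: "0 < c i \<and> shift c k i \<in> ?S \<or> 0 < c j \<and> shift c k j \<in> ?S \<or> shift \<sigma> i k \<in> ?S"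
        if p: "{i, j, k} = {1, 2, 3}" and h: "c \<in> ?S" "\<sigma> \<in> ?S" "c k < \<sigma> k" for i j k c \<sigma>
      proof (rule ccontr)
        assume neg: "\<not> ?thesis"
        have dist: "i \<noteq> j" "i \<noteq> k" "j \<noteq> k" and mem: "i \<in> {1..3}" "j \<in> {1..3}" "k \<in> {1..3}"
          using perm3_distinct[OF p] perm3_mem[OF p] by auto
        have S: "\<rho> \<in> tuples 3 \<and> deg 3 \<rho> = d" if "\<rho> \<in> ?S" for \<rho>
          using that by (simp add: covered_def)
        have eq: "\<rho> = shift \<rho>' a b"
          if "\<rho> \<in> ?S" "\<rho>' \<in> ?S" "a \<in> {1..3}" "b \<in> {1..3}" "a \<noteq> b" "0 < \<rho>' b"
            "\<rho> k = shift \<rho>' a b k" "\<rho> i = shift \<rho>' a b i" for \<rho> \<rho>' a b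
          using that S[of \<rho>] S[of \<rho>'] deg_shift[of a 3 b \<rho>'] shift_tuples[of \<rho>' 3 a b]
          by (intro tuple_eq_perm3[OF p]) auto
        have 1: "(c k, c i) \<in> T i k" using h by (auto simp: T_def)
        have 2: "(Suc (c k), c i) \<notin> T i k"
        proof
          assume "(Suc (c k), c i) \<in> T i k"
          then obtain \<rho> where \<rho>: "\<rho> \<in> ?S" "\<rho> k = Suc (c k)" "\<rho> i = c i" by (auto simp: T_def)
          have j: "0 < c j" using S[OF \<rho>(1)] S[OF h(1)] \<rho> by (simp add: deg_perm3[OF p])
          have "\<rho> = shift c k j"
            by (rule eq) (use \<rho> h mem dist j in \<open>auto simp: shift_def\<close>)
          with \<rho>(1) j neg show False by simp
        qed
        have 3: "(Suc (c k), z) \<notin> T i k" if "c i = Suc z" for z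
        proof
          assume "(Suc (c k), z) \<in> T i k"
          then obtain \<rho> where \<rho>: "\<rho> \<in> ?S" "\<rho> k = Suc (c k)" "\<rho> i = z" by (auto simp: T_def)
          have "\<rho> = shift c k i"
            by (rule eq) (use \<rho> h mem dist that in \<open>auto simp: shift_def\<close>)
          with \<rho>(1) that neg show False by simp
        qed
        have 4: "(Suc (\<sigma> k - 1), \<sigma> i) \<in> T i k" using h by (auto simp: T_def)
        have 5: "(\<sigma> k - 1, Suc (\<sigma> i)) \<notin> T i k"
        proof
          assume "(\<sigma> k - 1, Suc (\<sigma> i)) \<in> T i k"
          then obtain \<rho> where \<rho>: "\<rho> \<in> ?S" "\<rho> k = \<sigma> k - 1" "\<rho> i = Suc (\<sigma> i)" by (auto simp: T_def)
          have "\<rho> = shift \<sigma> i k"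
            by (rule eq) (use \<rho> h mem dist in \<open>auto simp: shift_def\<close>)
          with \<rho>(1) neg show False by simp
        qed
        have "card (T i k) \<le> card (shadow (T i k)) - card (T i k) - 1 choose 2"
          by (rule shadow_bound_strict[OF cT(2)[OF p] 1 2 3 4]) (use h(3) 5 in auto)
        also have "\<dots> \<le> N (Suc d) - N d - 1 choose 2"
          using sT[OF p] le card_covered_up_le[of 3 "set \<alpha>s" d] unfolding cT(1)[OF p]
          by (intro choose_two_mono) (simp add: N_def)
        finally show False using contra cT(1)[OF p] by simp
      qed
      have "D_cond 3 \<alpha>s (Suc d)"
      proof (rule D_condI)
        fix \<tau> \<sigma> \<sigma>' assume h: "Suc d < deg 3 \<tau>" "\<sigma> \<in> ?S" "\<sigma>' \<in> ?S" "\<sigma> \<le> \<tau>" "\<sigma>' \<le> \<tau>"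
        show "(linked 3 d ?S \<tau>)\<^sup>*\<^sup>* \<sigma> \<sigma>'"
        proof (rule linked_below[OF _ free h(2-5)])
          show "deg 3 \<tau> = Suc (d + (deg 3 \<tau> - Suc d))" using h(1) by simp
        qed (auto simp: covered_def)
      qed (use ac no_gen in \<open>auto simp: antichain_seq_def\<close>)
      with fail show False by simp
    qed
    with le G show ?thesis by simp
  qed
qed

section \<open>Growth in two coordinates and the number of points of a given degree\<close>

lemma deg_2: "deg 2 \<sigma> = \<sigma> 1 + \<sigma> 2"
  by (simp add: deg_def numeral_2_eq_2)

lemma tuple_eq_2:
  assumes "\<sigma> \<in> tuples 2" "\<sigma>' \<in> tuples 2" "deg 2 \<sigma> = deg 2 \<sigma>'" "\<sigma> 1 = \<sigma>' 1"
  shows "\<sigma> = \<sigma>'"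
proof
  fix l
  have "\<sigma> 2 = \<sigma>' 2" using assms(3,4) by (simp add: deg_2)
  then show "\<sigma> l = \<sigma>' l"
    using assms by (cases "l \<in> {1, 2}") (auto simp: tuples_def)
qed

lemma inj_on_covered_2: "inj_on (\<lambda>\<sigma>. \<sigma> 1) (covered 2 A d)"
  using tuple_eq_2 by (intro inj_onI) (auto simp: covered_def)

text \<open>Growth by only one leaves no room for a new generator and forces the first entries of
  the covered points to form an interval. Its points are connected by exchanges raising the first
  entry by one.\<close>

lemma D_cond_fail_2:
  assumes ac: "antichain_seq 2 \<alpha>s" and fail: "\<not> D_cond 2 \<alpha>s (Suc d)"
  shows "card (covered 2 (set \<alpha>s) d) + 2 \<le> card (covered 2 (set \<alpha>s) (Suc d))"
proof (cases "covered 2 (set \<alpha>s) d = {}")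
  case True
  then show ?thesis using D_cond_fail_start[OF ac fail] by simp
next
  case False
  let ?S = "covered 2 (set \<alpha>s) d"
  define T where "T = (\<lambda>\<sigma>. \<sigma> 1) ` ?S"
  have T: "finite T" "T \<noteq> {}" "card T = card ?S"
    using False finite_covered card_image[OF inj_on_covered_2] by (auto simp: T_def)
  have "spread T \<subseteq> (\<lambda>\<sigma>. \<sigma> 1) ` covered_up 2 (set \<alpha>s) d"
  proof
    fix y assume "y \<in> spread T"
    then obtain \<sigma> where \<sigma>: "\<sigma> \<in> ?S" "y = \<sigma> 1 \<or> y = Suc (\<sigma> 1)" by (auto simp: spread_def T_def)
    have "\<sigma>(l := Suc (\<sigma> l)) \<in> covered_up 2 (set \<alpha>s) d" if "l \<in> {1..2}" for l
      using \<sigma>(1) that by (auto simp: covered_up_def)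
    from this[of 1] this[of 2] \<sigma>(2) show "y \<in> (\<lambda>\<sigma>. \<sigma> 1) ` covered_up 2 (set \<alpha>s) d"
      by (elim disjE) (auto intro: rev_image_eqI)
  qed
  from surj_card_le[OF finite_covered_up this]
  have up: "card (spread T) \<le> card (covered_up 2 (set \<alpha>s) d)" .
  show ?thesis
  proof (cases "\<exists>\<alpha>\<in>set \<alpha>s. deg 2 \<alpha> = Suc d")
    case True
    then have "card (covered_up 2 (set \<alpha>s) d) < card (covered 2 (set \<alpha>s) (Suc d))"
      using card_covered_up_less[OF ac] by blast
    with up card_spread[OF T(1,2)] T(3) show ?thesis by simp
  next
    case no_gen: False
    show ?thesis
    proof (rule ccontr)
      assume "\<not> ?thesis"
      then have "\<not> card T + 2 \<le> card (spread T)"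
        using up card_covered_up_le[of 2 "set \<alpha>s" d] T(3) by linarith
      then have gap: "Suc x \<in> T" if "x \<in> T" "y \<in> T" "x < y" for x y
        using card_spread_gap[OF T(1)] that by blast
      have linked: "(linked 2 d ?S \<tau>)\<^sup>*\<^sup>* \<sigma> \<sigma>'"
        if "\<sigma> \<in> ?S" "\<sigma>' \<in> ?S" "\<sigma> \<le> \<tau>" "\<sigma>' \<le> \<tau>" "\<sigma> 1 \<le> \<sigma>' 1" for \<tau> \<sigma> \<sigma>'
        using that
      proof (induction "\<sigma>' 1 - \<sigma> 1" arbitrary: \<sigma>)
        case 0
        then have "\<sigma> = \<sigma>'" by (intro tuple_eq_2) (auto simp: covered_def)
        then show ?case by simp
      next
        case (Suc n)
        then have lt: "\<sigma> 1 < \<sigma>' 1" by simp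
        then have "Suc (\<sigma> 1) \<in> T" using gap[of "\<sigma> 1" "\<sigma>' 1"] Suc.prems by (simp add: T_def)
        then obtain \<rho> where \<rho>: "\<rho> \<in> ?S" "\<rho> 1 = Suc (\<sigma> 1)" by (auto simp: T_def)
        have S: "\<sigma> \<in> tuples 2" "deg 2 \<sigma> = d" "\<rho> \<in> tuples 2" "deg 2 \<rho> = d"
          using \<rho>(1) Suc.prems(1) by (auto simp: covered_def)
        then have "0 < \<sigma> 2" using \<rho>(2) by (simp add: deg_2)
        then have "\<rho> = shift \<sigma> 1 2"
          using S \<rho>(2) deg_shift[of 1 2 2 \<sigma>] shift_tuples[of \<sigma> 2 1 2]
          by (intro tuple_eq_2) (auto simp: shift_def)
        moreover have "\<sigma> 1 < \<tau> 1" using lt Suc.prems(4) by (auto simp: le_fun_def intro: less_le_trans)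
        ultimately have l: "linked 2 d ?S \<tau> \<sigma> \<rho>"
          using linked_shift[of \<sigma> ?S 1 2 2 d \<tau>] \<rho>(1) S Suc.prems by simp
        have "(linked 2 d ?S \<tau>)\<^sup>*\<^sup>* \<rho> \<sigma>'"
          using Suc.hyps(2) l \<rho> Suc.prems lt by (intro Suc.hyps(1)) (auto simp: linked_def)
        with l show ?case by (rule converse_rtranclp_into_rtranclp)
      qed
      have "D_cond 2 \<alpha>s (Suc d)"
      proof (rule D_condI)
        fix \<tau> \<sigma> \<sigma>' assume h: "\<sigma> \<in> ?S" "\<sigma>' \<in> ?S" "\<sigma> \<le> \<tau>" "\<sigma>' \<le> \<tau>"
        show "(linked 2 d ?S \<tau>)\<^sup>*\<^sup>* \<sigma> \<sigma>'"
          using linked[OF h] linked_sym[OF linked[OF h(2,1,4,3)]] by linarith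
      qed (use ac no_gen in \<open>auto simp: antichain_seq_def\<close>)
      with fail show False by simp
    qed
  qed
qed

lemma card_covered_2_le: "card (covered 2 A d) \<le> Suc d"
proof -
  have "(\<lambda>\<sigma>. \<sigma> 1) ` covered 2 A d \<subseteq> {..d}" by (auto simp: covered_def deg_2)
  from card_mono[OF _ this] card_image[OF inj_on_covered_2] show ?thesis by simp
qed

text \<open>The coordinates \<open>(\<sigma> 1 + \<sigma> 2, \<sigma> 1)\<close> arrange the points
  in a triangle with rows of lengths \<open>1, ..., d + 1\<close>.\<close>

lemma card_covered_3_le: "card (covered 3 A d) \<le> d + 2 choose 2"
proof -
  have p: "{1, 2, 3} = {1, 2, 3::nat}" ..
  have "inj_on (\<lambda>\<sigma>. (\<sigma> 1 + \<sigma> 2, \<sigma> 1)) (covered 3 A d)"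
  proof (rule inj_onI)
    fix \<sigma> \<sigma>' assume h: "\<sigma> \<in> covered 3 A d" "\<sigma>' \<in> covered 3 A d"
      "(\<sigma> 1 + \<sigma> 2, \<sigma> 1) = (\<sigma>' 1 + \<sigma>' 2, \<sigma>' 1)"
    then show "\<sigma> = \<sigma>'"
      by (intro tuple_eq_perm3[OF p]) (auto simp: covered_def deg_perm3[OF p])
  qed
  then have "card (covered 3 A d) = card ((\<lambda>\<sigma>. (\<sigma> 1 + \<sigma> 2, \<sigma> 1)) ` covered 3 A d)"
    by (simp add: card_image)
  also have "\<dots> \<le> card (Sigma {..d} (\<lambda>w. {..w}))"
    by (intro card_mono) (auto simp: covered_def deg_perm3[OF p])
  also have "\<dots> = (\<Sum>w\<le>d. Suc w)" by simp
  also have "\<dots> = d + 2 choose 2" by (induction d) (auto simp: Suc_choose_two numeral_2_eq_2)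
  finally show ?thesis .
qed

section \<open>Upper bounds\<close>

text \<open>The invariant says that \<open>N d\<close> fills the first \<open>s\<close> of the \<open>s + u\<close> rows of the
  triangle of points of degree \<open>d\<close>. The growth forced by the first premise completes the partial
  row after \<open>s + 2\<close> further degrees, at which point \<open>2 * s + 3\<close> rows are full.\<close>

lemma growth_contradiction:
  fixes N :: "nat \<Rightarrow> nat"
  assumes "\<And>e. d \<le> e \<Longrightarrow> e + 3 < (s + 3) * 2 ^ u \<Longrightarrow> N e \<le> N (Suc e) - N e - 1 choose 2"
    and "\<And>e. N e \<le> e + 2 choose 2"
    and "Suc s choose 2 \<le> N d" "0 < s" "Suc d = s + u"
  shows False
  using assms(1,3-5)
proof (induction u arbitrary: s d)
  case 0
  \<comment> \<open>Here \<open>s = d + 1\<close>, so degree \<open>d\<close> is full. The next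
    growth would be at least \<open>s + 2\<close>, whereas the triangle gains only
    \<open>s + 1\<close> points.\<close>
  have "s choose 2 < Suc s choose 2" using \<open>0 < s\<close> by (simp add: Suc_choose_two)
  also have "\<dots> \<le> N (Suc d) - N d - 1 choose 2"
    using 0(1)[of d] 0(2,4) by simp
  finally have "s < N (Suc d) - N d - 1" using choose_two_mono by (meson leD leI)
  then show False
    using 0(2,4) assms(2)[of "Suc d"] by (simp add: Suc_choose_two)
next
  case (Suc u)
  have range: "e + 3 < (s + 3) * 2 ^ Suc u" if "e < d + s + 2" for e
  proof -
    have "u + 1 \<le> 2 ^ u" by (simp add: Suc_le_eq)
    then have "(2 * s + 6) * (u + 1) \<le> (2 * s + 6) * 2 ^ u"
      by (rule mult_le_mono2)
    moreover have "2 * s + u + 4 < (2 * s + 6) * (u + 1)" by (simp add: algebra_simps)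
    ultimately show ?thesis using that Suc.prems(4) by (simp add: algebra_simps)
  qed
  have step: "N e + g + 2 \<le> N (Suc e)" if "d \<le> e" "e < d + s + 2" "g choose 2 < N e" for e g
  proof -
    have "g choose 2 < N (Suc e) - N e - 1 choose 2"
      using Suc.prems(1)[OF that(1) range[OF that(2)]] that(3) by simp
    then have "g < N (Suc e) - N e - 1" using choose_two_mono by (meson leD leI)
    then show ?thesis by simp
  qed
  \<comment> \<open>Each degree completes another row and adds two points to the surplus, which is
    \<open>1 + 2 * l\<close>. At \<open>l = s + 1\<close> the surplus is \<open>2 * s + 3\<close>,
    exactly the length of the next row.\<close>
  have rows: "(s + 2 + l choose 2) + 1 + 2 * l \<le> N (d + 1 + l)" if "l \<le> s + 1" for l
    using that
  proof (induction l)
    case 0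
    have "s choose 2 < N d" using Suc.prems(2,3) by (simp add: Suc_choose_two)
    from step[OF _ _ this] Suc.prems(2) show ?case by (simp add: Suc_choose_two)
  next
    case (Suc l)
    have "s + 2 + l choose 2 < N (d + 1 + l)" using Suc by simp
    from step[OF _ _ this] Suc show ?case by (simp add: Suc_choose_two)
  qed
  show False
  proof (rule Suc.IH)
    \<comment> \<open>Passing from \<open>s\<close> to \<open>2 * s + 3\<close> doubles
      \<open>s + 3\<close>, which absorbs one factor 2 of the bound on the range of
      \<open>e\<close>.\<close>
    have eq: "s + 2 + (s + 1) = 2 * s + 3" "d + 1 + (s + 1) = d + s + 2" by simp_all
    show "Suc (2 * s + 3) choose 2 \<le> N (d + s + 2)"
      using rows[of "s + 1"] unfolding eq Suc_choose_two by simp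
    fix e assume "d + s + 2 \<le> e" "e + 3 < (2 * s + 3 + 3) * 2 ^ u"
    then show "N e \<le> N (Suc e) - N e - 1 choose 2"
      by (intro Suc.prems(1)) (auto simp: algebra_simps)
  qed (use Suc.prems(4) in auto)
qed

text \<open>Only the zero tuple has degree 0, so there is no pair to form a \<open>LUB\<close>. This
  settles \<open>r = 0\<close>, as the growth lemmas concern \<open>Suc d\<close> only.\<close>

lemma D_cond_0:
  assumes "antichain_seq m \<alpha>s"
  shows "D_cond m \<alpha>s 0"
proof -
  have "\<alpha> = (\<lambda>k. 0)" if "\<alpha> \<in> seq_upto m \<alpha>s 0" for \<alpha>
    using that assms unfolding seq_upto_def antichain_seq_def
    by (intro deg_eq_imp_eq[of _ _ m, symmetric]) (auto simp: le_fun_def tuples_def)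
  then have "lubs (seq_upto m \<alpha>s 0) = {}" unfolding lubs_def by blast
  then show ?thesis by (simp add: D_cond_def)
qed

lemma D_val_le: "r \<le> p \<Longrightarrow> D_cond m \<alpha>s p \<Longrightarrow> D_val m r \<alpha>s \<le> p"
  unfolding D_val_def by (rule Least_le) simp

lemma D_val_2_le:
  assumes ac: "antichain_seq 2 \<alpha>s"
  shows "D_val 2 r \<alpha>s \<le> 2 * r"
proof (cases "r = 0")
  case True
  then show ?thesis using D_val_le[OF _ D_cond_0[OF ac], of r] by simp
next
  case False
  have "\<exists>p. r \<le> p \<and> p \<le> 2 * r \<and> D_cond 2 \<alpha>s p"
  proof (rule ccontr)
    assume contra: "\<not> ?thesis"
    \<comment> \<open>After \<open>r + 1\<close> failures degree \<open>2 * r\<close> would contain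
      \<open>2 * r + 2\<close> covered points, one more than there are.\<close>
    have "2 * l \<le> card (covered 2 (set \<alpha>s) (r - 1 + l))" if "l \<le> Suc r" for l
      using that
    proof (induction l)
      case (Suc l)
      have "\<not> D_cond 2 \<alpha>s (Suc (r - 1 + l))" using contra False Suc.prems by auto
      from D_cond_fail_2[OF ac this] Suc show ?case by simp
    qed simp
    from this[of "Suc r"] card_covered_2_le[of "set \<alpha>s" "2 * r"] False
    show False by (simp add: mult_2)
  qed
  then show ?thesis using D_val_le order_trans by blast
qed

lemma D_val_3_le:
  assumes ac: "antichain_seq 3 \<alpha>s"
  shows "D_val 3 r \<alpha>s \<le> 3 * (2 ^ r - 1)"
proof (cases "r = 0")
  case True
  then show ?thesis using D_val_le[OF _ D_cond_0[OF ac], of r] by simp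
next
  case False
  then obtain u where u: "r = Suc u" by (cases r) auto
  define N where "N d = card (covered 3 (set \<alpha>s) d)" for d
  have "\<exists>p. r \<le> p \<and> p \<le> 3 * (2 ^ r - 1) \<and> D_cond 3 \<alpha>s p"
  proof (rule ccontr)
    assume contra: "\<not> ?thesis"
    have fail: "N d + 2 \<le> N (Suc d) \<and> N d \<le> N (Suc d) - N d - 1 choose 2"
      if "u \<le> d" "d + 3 < 6 * 2 ^ u" for d
      unfolding N_def
    proof (rule D_cond_fail_3[OF ac])
      show "\<not> D_cond 3 \<alpha>s (Suc d)" using contra that by (simp add: u)
    qed
    have u: "u + 4 < 6 * 2 ^ u" using less_exp[of u] by linarith
    then have N2: "2 \<le> N (Suc u)" using fail[of u] by simp
    \<comment> \<open>The failures at \<open>r\<close> and \<open>r + 1\<close> force at least 2 and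
      then 6 covered points. Six points fill three rows of the triangle of degree
      \<open>u + 2\<close>, whence \<open>s = 3\<close>; the range \<open>6 * 2 ^ u\<close> is
      \<open>3 * 2 ^ r\<close>.\<close>
    show False
    proof (rule growth_contradiction[where s = 3 and u = u and d = "u + 2" and N = N])
      have "2 choose 2 < N (Suc u)" using N2 by simp
      also have "N (Suc u) \<le> N (u + 2) - N (Suc u) - 1 choose 2"
        using fail[of "Suc u"] u by simp
      finally have "2 < N (u + 2) - N (Suc u) - 1" using choose_two_mono by (meson leD leI)
      then have "6 \<le> N (u + 2)" using N2 by simp
      then show "Suc 3 choose 2 \<le> N (u + 2)" by (simp add: Suc_choose_two numeral_eq_Suc)
    next
      show "N e \<le> e + 2 choose 2" for e unfolding N_def by (rule card_covered_3_le)
    qed (use fail in auto)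
  qed
  then show ?thesis using D_val_le order_trans by blast
qed

section \<open>Lower bounds\<close>

lemma D_val_ge:
  assumes "antichain_seq m \<alpha>s" "\<And>p. r \<le> p \<Longrightarrow> p < P \<Longrightarrow> \<not> D_cond m \<alpha>s p"
  shows "P \<le> D_val m r \<alpha>s"
proof -
  have "r \<le> D_val m r \<alpha>s \<and> D_cond m \<alpha>s (D_val m r \<alpha>s)"
    unfolding D_val_def using D_cond_exists[OF assms(1), of r] by (rule LeastI_ex)
  then show ?thesis using assms(2) not_less by blast
qed

text \<open>Since \<open>\<phi>\<close> attains entry \<open>i\<close> of the \<open>LUB\<close>, a
  sequence must start at \<open>\<epsilon>\<close>; since \<open>\<epsilon>\<close> attains entry
  \<open>j\<close>, it must end at \<open>\<phi>\<close>. No other element is available, and the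
  step between the two exceeds degree \<open>p\<close>.\<close>

lemma not_D_condI:
  assumes "set \<alpha>s \<subseteq> tuples m" "\<epsilon> \<in> seq_upto m \<alpha>s p" "\<phi> \<in> seq_upto m \<alpha>s p"
    and ij: "i \<in> {1..m}" "j \<in> {1..m}" "i < j" "\<epsilon> i < \<phi> i" "\<phi> j < \<epsilon> j"
    and deg: "p < deg m (LUB \<epsilon> \<phi>)"
    and only: "\<And>\<eta>. \<eta> \<in> seq_upto m \<alpha>s p \<Longrightarrow> \<eta> \<le> LUB \<epsilon> \<phi> \<Longrightarrow> \<eta> = \<epsilon> \<or> \<eta> = \<phi>"
  shows "\<not> D_cond m \<alpha>s p"
proof
  let ?\<tau> = "LUB \<epsilon> \<phi>"
  assume D: "D_cond m \<alpha>s p"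
  have \<tau>: "?\<tau> \<in> lubs (seq_upto m \<alpha>s p) - tuples_upto m p"
    using assms(2,3) ij deg by (auto simp: lubs_def tuples_upto_def)
  have "below_pred \<epsilon> ?\<tau> i" "below_pred \<phi> ?\<tau> j"
    using ij by (auto simp: below_pred_int unit_tuple_def sup_nat_def)
  then have "\<exists>\<beta>1\<in>seq_upto m \<alpha>s p. \<exists>\<beta>2\<in>seq_upto m \<alpha>s p. below_pred \<beta>1 ?\<tau> i \<and> below_pred \<beta>2 ?\<tau> j"
    using assms(2,3) by blast
  from D[unfolded D_cond_def, THEN bspec, OF \<tau>, THEN bspec, OF ij(1), THEN bspec, OF ij(2),
      THEN mp, OF ij(3), THEN mp, OF this]
  obtain s \<eta> k where s: "1 \<le> s" and \<eta>: "\<And>l. l \<in> {1..s} \<Longrightarrow> \<eta> l \<in> seq_upto m \<alpha>s p"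
    and k: "k (1::nat) = i" "k s = j" and b: "\<And>l. l \<in> {1..s} \<Longrightarrow> below_pred (\<eta> l) ?\<tau> (k l)"
    and c: "\<And>l. l \<in> {1..<s} \<Longrightarrow> deg m (LUB (\<eta> l) (\<eta> (Suc l))) \<le> p"
    by blast
  have lt: "\<eta> l (k l) < ?\<tau> (k l)" and le: "\<eta> l \<le> ?\<tau>" if "l \<in> {1..s}" for l
  proof -
    have *: "int (\<eta> l x) \<le> int (?\<tau> x) - int (unit_tuple (k l) x)" for x
      using b[OF that] unfolding below_pred_int by blast
    from *[of "k l"] show "\<eta> l (k l) < ?\<tau> (k l)" by (simp add: unit_tuple_def)
    show "\<eta> l \<le> ?\<tau>"
    proof (rule le_funI)
      fix x show "\<eta> l x \<le> ?\<tau> x" using *[of x] by linarith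
    qed
  qed
  have "l \<le> s \<Longrightarrow> \<eta> l = \<epsilon>" if "1 \<le> l" for l
    using that
  proof (induction l rule: dec_induct)
    case base
    have "\<eta> 1 \<noteq> \<phi>" using lt[of 1] s k ij by (auto simp: sup_nat_def)
    then show ?case using only[OF \<eta> le, of 1] s by auto
  next
    case (step l)
    then have "\<eta> (Suc l) \<noteq> \<phi>" using c[of l] deg by auto
    then show ?case using only[OF \<eta> le, of "Suc l"] step by auto
  qed
  then have "\<eta> s = \<epsilon>" using s by simp
  then show False using lt[of s] s k ij by (auto simp: sup_nat_def)
qed

section \<open>Explicit antichains\<close>

definition triple :: "nat \<Rightarrow> nat \<Rightarrow> nat \<Rightarrow> tuple" where
  "triple x y z = (\<lambda>k. if k = 1 then x else if k = 2 then y else if k = 3 then z else 0)"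

lemma triple_sel [simp]:
  "triple x y z (Suc 0) = x" "triple x y z 2 = y" "triple x y z 3 = z"
  by (auto simp: triple_def)

lemma triple_tuples: "triple x y z \<in> tuples 3" "triple x y 0 \<in> tuples 2"
  by (auto simp: triple_def tuples_def)

lemma deg_triple: "deg 3 (triple x y z) = x + y + z" "deg 2 (triple x y z) = x + y"
  by (simp_all add: deg_perm3[OF refl] deg_2)

lemma triple_le_iff: "triple x y z \<le> triple x' y' z' \<longleftrightarrow> x \<le> x' \<and> y \<le> y' \<and> z \<le> z'"
proof
  assume le: "triple x y z \<le> triple x' y' z'"
  show "x \<le> x' \<and> y \<le> y' \<and> z \<le> z'"
    using le_funD[OF le, of 1] le_funD[OF le, of 2] le_funD[OF le, of 3] by simp
qed (simp add: triple_def le_fun_def)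

lemma LUB_triple: "LUB (triple x y z) (triple x' y' z') = triple (max x x') (max y y') (max z z')"
  by (auto simp: triple_def LUB_entrywise)

text \<open>The two generators \<open>(r, 0)\<close> and \<open>(0, r)\<close> have a
  \<open>LUB\<close> of degree \<open>2 * r\<close>, so they stay unconnected for all smaller
  \<open>p\<close>.\<close>

lemma D_val_2_attained: "\<exists>\<alpha>s. antichain_seq 2 \<alpha>s \<and> 2 * r \<le> D_val 2 r \<alpha>s"
proof (cases "r = 0")
  case True
  then show ?thesis by (intro exI[of _ "[]"]) (simp add: antichain_seq_def)
next
  case False
  let ?A = "[triple r 0 0, triple 0 r 0]"
  have ac: "antichain_seq 2 ?A"
    using False by (auto simp: antichain_seq_def triple_tuples less_Suc_eq nth_Cons triple_le_iff
        split: nat.splits)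
  have "2 * r \<le> D_val 2 r ?A"
  proof (rule D_val_ge[OF ac])
    fix p assume p: "r \<le> p" "p < 2 * r"
    show "\<not> D_cond 2 ?A p"
      by (rule not_D_condI[of _ _ "triple 0 r 0" _ "triple r 0 0" 1 2])
        (use p False in \<open>auto simp: triple_tuples seq_upto_def deg_triple LUB_triple\<close>)
  qed
  with ac show ?thesis by blast
qed

text \<open>The solution of \<open>L 0 = 1\<close>, \<open>L (Suc b) = 2 * L b + 2\<close>. With it,
  the degrees of each block begin right after those of the preceding one.\<close>

definition block_len :: "nat \<Rightarrow> nat" where
  "block_len b = 3 * 2 ^ b - 2"

lemma block_len: "block_len b + 2 = 3 * 2 ^ b"
proof -
  have "(1::nat) \<le> 2 ^ b" by simp
  then show ?thesis unfolding block_len_def by linarith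
qed

lemma block_len_pos: "0 < block_len b"
proof -
  have "(1::nat) \<le> 2 ^ b" by simp
  then show ?thesis using block_len[of b] by linarith
qed

lemma block_len_Suc: "block_len (Suc b) = 2 * block_len b + 2"
  using block_len[of b] block_len[of "Suc b"] by simp

lemma block_len_less: "b < b' \<Longrightarrow> 2 * block_len b + 1 + (b' - b) \<le> block_len b'"
  by (induction b' rule: less_Suc_induct) (auto simp: block_len_Suc)

text \<open>Generators of a lexicographic ideal with two generators in degree \<open>r\<close> and exactly one in each
  of the degrees from \<open>r + 1\<close> to \<open>3 * (2 ^ r - 1) - 1\<close>. The \<open>LUB\<close> of each of them with its
  predecessor has a degree that is too large by one.\<close>

definition block :: "nat \<Rightarrow> nat \<Rightarrow> nat \<Rightarrow> tuple" where
  "block r b i = triple (r - 1 - b) (block_len b - i) (2 * i)"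

definition lex_antichain :: "nat \<Rightarrow> tuple set" where
  "lex_antichain r = insert (triple r 0 0) (\<Union>b<r. block r b ` {..block_len b})"

lemma lex_antichain_cases:
  assumes "\<eta> \<in> lex_antichain r"
  obtains "\<eta> = triple r 0 0" | b i where "b < r" "i \<le> block_len b" "\<eta> = block r b i"
  using assms by (auto simp: lex_antichain_def)

lemma deg_block: "i \<le> block_len b \<Longrightarrow> deg 3 (block r b i) = r - 1 - b + block_len b + i"
  by (simp add: block_def deg_triple)

text \<open>The degrees of the blocks below \<open>n\<close> fill the stated range, and block
  \<open>n\<close> starts at the first degree beyond it.\<close>

lemma block_degree:
  "n \<le> r \<Longrightarrow> r \<le> p \<Longrightarrow> p + 3 < r - n + 3 * 2 ^ n \<Longrightarrow>
    \<exists>b<n. \<exists>i\<le>block_len b. p = r - 1 - b + block_len b + i"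
proof (induction n)
  case (Suc n)
  show ?case
  proof (cases "p + 3 < r - n + 3 * 2 ^ n")
    case True
    then show ?thesis using Suc by (auto simp: less_Suc_eq)
  next
    case False
    then have "p = r - 1 - n + block_len n + (p + 3 - (r - n + 3 * 2 ^ n))"
      and "p + 3 - (r - n + 3 * 2 ^ n) \<le> block_len n"
      using Suc.prems block_len[of n] by auto
    then show ?thesis by blast
  qed
qed simp

lemma block_degree_less:
  assumes "b < b'" "b' < r" "i \<le> block_len b"
  shows "deg 3 (block r b i) < r - 1 - b' + block_len b' + i'"
  using assms block_len_less[OF assms(1)] by (simp add: deg_block)

text \<open>For two blocks the first entry forces \<open>b' \<le> b\<close> and the third
  \<open>i \<le> i'\<close>. The second then forces \<open>block_len b \<le> block_len b'\<close>,
  hence equality of the blocks and of the indices.\<close>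

lemma lex_antichain_le:
  assumes "0 < r" "\<eta> \<in> lex_antichain r" "\<theta> \<in> lex_antichain r" "\<eta> \<le> \<theta>"
  shows "\<eta> = \<theta>"
  using assms(2)
proof (cases rule: lex_antichain_cases)
  case 1
  show ?thesis
    using assms(3)
    by (cases rule: lex_antichain_cases) (use 1 assms in \<open>auto simp: block_def triple_le_iff\<close>)
next
  case (2 b i)
  note \<eta> = 2
  show ?thesis
    using assms(3)
  proof (cases rule: lex_antichain_cases)
    case 1
    then show ?thesis using 2 assms(4) block_len_pos[of b] by (auto simp: block_def triple_le_iff)
  next
    case (2 b' i')
    then have le: "b' \<le> b" "block_len b - i \<le> block_len b' - i'" "i \<le> i'"
      using \<eta> assms(4) by (auto simp: block_def triple_le_iff)
    then have "b' = b"
      using block_len_less[of b' b] 2(2) \<eta>(2) by (cases "b' = b") auto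
    moreover from this have "i = i'" using le \<eta>(2) 2(2) by simp
    ultimately show ?thesis using 2(3) \<eta>(3) by simp
  qed
qed

lemma D_val_3_attained: "\<exists>\<alpha>s. antichain_seq 3 \<alpha>s \<and> 3 * (2 ^ r - 1) \<le> D_val 3 r \<alpha>s"
proof (cases "r = 0")
  case True
  then show ?thesis by (intro exI[of _ "[]"]) (simp add: antichain_seq_def)
next
  case False
  have "finite (lex_antichain r)" by (simp add: lex_antichain_def)
  then obtain \<alpha>s where \<alpha>s: "set \<alpha>s = lex_antichain r" "distinct \<alpha>s"
    using finite_distinct_list by blast
  have tup: "set \<alpha>s \<subseteq> tuples 3"
    by (auto simp: \<alpha>s lex_antichain_def block_def triple_tuples)
  have ac: "antichain_seq 3 \<alpha>s"
    unfolding antichain_seq_def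
  proof (intro conjI tup allI impI notI)
    fix a b assume h: "a < length \<alpha>s" "b < length \<alpha>s" "a \<noteq> b" "\<alpha>s ! a \<le> \<alpha>s ! b"
    then have "\<alpha>s ! a = \<alpha>s ! b"
      using lex_antichain_le[of r "\<alpha>s ! a" "\<alpha>s ! b"] False \<alpha>s(1) nth_mem by blast
    with h \<alpha>s(2) show False by (simp add: nth_eq_iff_index_eq)
  qed
  have "3 * (2 ^ r - 1) \<le> D_val 3 r \<alpha>s"
  proof (rule D_val_ge[OF ac])
    fix p assume p: "r \<le> p" "p < 3 * (2 ^ r - 1)"
    then have "p + 3 < r - r + 3 * 2 ^ r" by (simp add: diff_mult_distrib2 less_diff_conv)
    then obtain b i where bi: "b < r" "i \<le> block_len b" "p = r - 1 - b + block_len b + i"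
      using block_degree[of r r p] p(1) by blast
    have upto: "\<eta> \<in> seq_upto 3 \<alpha>s p \<longleftrightarrow> \<eta> \<in> lex_antichain r \<and> deg 3 \<eta> \<le> p" for \<eta>
      by (simp add: seq_upto_def \<alpha>s)
    have blk: "block r b' i' \<in> seq_upto 3 \<alpha>s p"
      if "b' < r" "i' \<le> block_len b'" "deg 3 (block r b' i') \<le> p" for b' i'
      using that by (auto simp: upto lex_antichain_def)
    \<comment> \<open>Blocks after \<open>b\<close> are excluded by degree; blocks before it will be
      excluded by their first entry.\<close>
    have later: "b' \<le> b" if "deg 3 (block r b' i') \<le> p" "b' < r" "i' \<le> block_len b'" for b' i'
      using block_degree_less[of b b' r i i'] that bi by (force simp: deg_block)
    have top: "triple r 0 0 \<in> seq_upto 3 \<alpha>s p"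
      using p(1) by (auto simp: upto lex_antichain_def deg_triple)
    show "\<not> D_cond 3 \<alpha>s p"
    proof (cases i)
      case (Suc i0)
      \<comment> \<open>Replacing \<open>block_len b - i\<close> by \<open>block_len b - i0\<close>
        raises the second entry by one, so this \<open>LUB\<close> has degree
        \<open>p + 1\<close>.\<close>
      have L: "LUB (block r b i) (block r b i0) = triple (r - 1 - b) (block_len b - i0) (2 * i)"
        using bi(2) by (auto simp: block_def LUB_triple Suc max_def)
      show ?thesis
      proof (rule not_D_condI[OF tup, of "block r b i" p "block r b i0" 2 3])
        show "block r b i \<in> seq_upto 3 \<alpha>s p" "block r b i0 \<in> seq_upto 3 \<alpha>s p"
          using blk[of b i] blk[of b i0] bi Suc by (simp_all add: deg_block)
        show "p < deg 3 (LUB (block r b i) (block r b i0))"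
          using bi Suc unfolding L by (simp add: deg_triple)
        show "\<eta> = block r b i \<or> \<eta> = block r b i0"
          if h: "\<eta> \<in> seq_upto 3 \<alpha>s p" "\<eta> \<le> LUB (block r b i) (block r b i0)" for \<eta>
        proof -
          have "\<eta> \<in> lex_antichain r" using h(1) by (simp add: upto)
          then show ?thesis
          proof (cases rule: lex_antichain_cases)
            case 1
            then show ?thesis using h(2) False unfolding L by (simp add: triple_le_iff)
          next
            case (2 b' i')
            have "b' \<le> b" using later[of b' i'] h(1) 2 by (simp add: upto)
            moreover have "r - 1 - b' \<le> r - 1 - b"
              using h(2) 2 unfolding L by (simp add: block_def triple_le_iff)
            then have "b \<le> b'" using bi(1) 2(1) by linarith
            ultimately have "b' = b" by simp
            moreover from this have "i' = i \<or> i' = i0"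
              using h(2) 2 bi Suc unfolding L by (auto simp: block_def triple_le_iff)
            ultimately show ?thesis using 2(3) by blast
          qed
        qed
      qed (use bi Suc in \<open>auto simp: block_def\<close>)
    next
      case 0
      \<comment> \<open>At the start of a block the partner is the initial element of the preceding
        block, not its last one: its third entry 0 keeps the degree of the \<open>LUB\<close> at
        \<open>p + 1\<close>. For \<open>b = 0\<close> it is \<open>triple r 0 0\<close>.\<close>
      define y where "y = (if b = 0 then 0 else block_len (b - 1))"
      define \<phi> where "\<phi> = triple (r - b) y 0"
      have \<phi>: "\<phi> = (if b = 0 then triple r 0 0 else block r (b - 1) 0)"
        using bi(1) by (auto simp: \<phi>_def y_def block_def)
      have y: "y < block_len b"
        using block_len_less[of "b - 1" b] block_len_pos[of b] by (auto simp: y_def)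
      have L: "LUB (block r b 0) \<phi> = triple (r - b) (block_len b) 0"
        using bi(1) y by (auto simp: block_def \<phi>_def LUB_triple)
      show ?thesis
      proof (rule not_D_condI[OF tup, of "block r b 0" p \<phi> 1 2])
        show "block r b 0 \<in> seq_upto 3 \<alpha>s p"
          using blk[of b 0] bi 0 by (simp add: deg_block)
        show "\<phi> \<in> seq_upto 3 \<alpha>s p"
        proof (cases "b = 0")
          case True
          then show ?thesis using top by (simp add: \<phi>)
        next
          case False
          have "deg 3 \<phi> \<le> p" using bi 0 y by (simp add: \<phi>_def deg_triple)
          then show ?thesis using blk[of "b - 1" 0] bi(1) False by (simp add: \<phi>)
        qed
        show "p < deg 3 (LUB (block r b 0) \<phi>)"
          using bi 0 unfolding L by (simp add: deg_triple)
        show "\<eta> = block r b 0 \<or> \<eta> = \<phi>"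
          if h: "\<eta> \<in> seq_upto 3 \<alpha>s p" "\<eta> \<le> LUB (block r b 0) \<phi>" for \<eta>
        proof -
          have "\<eta> \<in> lex_antichain r" using h(1) by (simp add: upto)
          then show ?thesis
          proof (cases rule: lex_antichain_cases)
            case 1
            then have "b = 0" using h(2) bi(1) unfolding L by (simp add: triple_le_iff)
            then show ?thesis using 1 by (simp add: \<phi>)
          next
            case (2 b' i')
            have "b' \<le> b" using later[of b' i'] h(1) 2 by (simp add: upto)
            moreover have "r - 1 - b' \<le> r - b" and i': "i' = 0"
              using h(2) 2 unfolding L by (auto simp: block_def triple_le_iff)
            then have "b \<le> Suc b'" using bi(1) 2(1) by linarith
            ultimately have "b' = b \<or> b \<noteq> 0 \<and> b' = b - 1" by auto
            then show ?thesis using 2(3) i' by (auto simp: \<phi>)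
          qed
        qed
      qed (use bi y in \<open>auto simp: block_def \<phi>_def\<close>)
    qed
  qed
  with ac show ?thesis by blast
qed

text \<open>The upper bound also supplies the finiteness without which \<open>Max\<close> would be
  meaningless.\<close>

lemma C1_eqI:
  assumes "\<And>\<alpha>s. antichain_seq m \<alpha>s \<Longrightarrow> D_val m r \<alpha>s \<le> P"
    and "\<exists>\<alpha>s. antichain_seq m \<alpha>s \<and> P \<le> D_val m r \<alpha>s"
  shows "finite (D_values r m) \<and> C1 r m = P"
proof -
  have sub: "D_values r m \<subseteq> {..P}" using assms(1) by (auto simp: D_values_def)
  then have "finite (D_values r m)" by (rule finite_subset) simp
  moreover have "P \<in> D_values r m"
    using assms le_antisym unfolding D_values_def by blast
  ultimately show ?thesis unfolding C1_def using sub by (auto intro!: Max_eqI)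
qed

theorem corollary34:
  fixes r :: nat
  shows "finite (D_values r 2) \<and> C1 r 2 = 2 * r \<and>
         finite (D_values r 3) \<and> C1 r 3 = 3 * (2 ^ r - 1)"
  using C1_eqI[of 2 r "2 * r", OF D_val_2_le D_val_2_attained]
    C1_eqI[of 3 r "3 * (2 ^ r - 1)", OF D_val_3_le D_val_3_attained] by blast

end
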